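(* There is an equivalence relation $E$ on a Polish space $X$ which is Borel graphable, but such that every Borel graphing of $E$ has diameter at least $3$.
   Context: Let $E$ be an equivalence relation on a Polish space $X$. A Borel graphing of $E$ is a Borel graph $G$ on $X$ (a Borel symmetric irreflexive subset of $X\times X$) such that for all $x,y\in X$, $x\,E\,y$ holds if and only if there is a path in $G$ between $x$ and $y$ (by convention there is always a path of length $0$ from $x$ to itself); i.e. the connected components of $G$ are exactly the $E$-classes. $E$ is Borel graphable if it has a Borel graphing. For $E$-equivalent $x,y$, $\mathrm{dist}_G(x,y)$ is the length of a shortest path in $G$ between $x$ and $y$, and the diameter of $G$ is $\sup\{\mathrm{dist}_G(x,y) : x\,E\,y\}$ (equal to $\infty$ if this set is unbounded). *)

theory Defs
  imports "HOL-Analysis.Analysis" "HOL-Library.Extended_Nat"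
begin

definition polish_topology :: "'a topology \<Rightarrow> bool" where
  "polish_topology X \<longleftrightarrow> completely_metrizable_space X \<and> separable_space X"

definition borel_in :: "'a topology \<Rightarrow> 'a set \<Rightarrow> bool" where
  "borel_in X A \<longleftrightarrow> A \<in> sigma_sets (topspace X) {U. openin X U}"

definition borel_graph :: "'a topology \<Rightarrow> ('a \<times> 'a) set \<Rightarrow> bool" where
  "borel_graph X G \<longleftrightarrow> borel_in (prod_topology X X) G \<and> sym G \<and> irrefl G"

text \<open>
  A path of length \<open>n\<close> is a sequence of \<open>n + 1\<close> vertices, repetitions allowed, whose
  consecutive members are adjacent (\<open>relpow_fun_conv\<close>). Allowing repetitions changes neither
  which vertices are joined by a path nor the length of a shortest path.
\<close>

definition path_of_length :: "('a \<times> 'a) set \<Rightarrow> nat \<Rightarrow> 'a \<Rightarrow> 'a \<Rightarrow> bool" where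
  "path_of_length G n x y \<longleftrightarrow> (x, y) \<in> G ^^ n"

definition borel_graphing :: "'a topology \<Rightarrow> ('a \<times> 'a) set \<Rightarrow> ('a \<times> 'a) set \<Rightarrow> bool" where
  "borel_graphing X E G \<longleftrightarrow> borel_graph X G \<and>
     (\<forall>x\<in>topspace X. \<forall>y\<in>topspace X. (x, y) \<in> E \<longleftrightarrow> (\<exists>n. path_of_length G n x y))"

definition borel_graphable :: "'a topology \<Rightarrow> ('a \<times> 'a) set \<Rightarrow> bool" where
  "borel_graphable X E \<longleftrightarrow> (\<exists>G. borel_graphing X E G)"

text \<open>The infimum of the empty set is \<open>\<infinity>\<close>, so unconnected vertices have distance \<open>\<infinity>\<close>.\<close>

definition graph_dist :: "('a \<times> 'a) set \<Rightarrow> 'a \<Rightarrow> 'a \<Rightarrow> enat" where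
  "graph_dist G x y = (INF n\<in>{n. path_of_length G n x y}. enat n)"

definition graph_diameter :: "('a \<times> 'a) set \<Rightarrow> ('a \<times> 'a) set \<Rightarrow> enat" where
  "graph_diameter E G = (SUP (x, y)\<in>E. graph_dist G x y)"

end

theory Submission
  imports Defs "HOL-Library.Nat_Bijection"
begin

text \<open>
  Consider infinitely branching trees whose leaves carry truth values, an inner node being true if
  all its children are false, and false if exactly one child is true. A labelling x of all nodes
  is evidence for the truth of the root; its blurred version only shows the leaves. Whether evidence
  exists is an analytic, non-Borel question, but on a well-founded tree it is unique.

  Take pairs of blurred trees, joined by a path of length three from (blur x, blur y) through
  (x, blur y) and (blur x, y) to a second copy of (blur x, blur y), where the inner vertices are
  present only if x, respectively y, makes its root true. A graphing of diameter two needs, on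
  well-founded trees, an edge from vertex 0 or 1 to vertex 3, or from vertex 0 to vertex 2; so it
  decides in a Borel way the truth of a tree that it only sees blurred, given full evidence for
  the other one. Fix a well-founded shape of rank above that of the graphing. By Baire category
  one of the two cases occurs on a non-meager set of pairs of true trees; but a Borel set of smaller
  rank that is non-meager on the true trees is non-meager on the false trees too, which is absurd.
\<close>

section \<open>Relative Baire category on spaces of functions\<close>

text \<open>For finite \<open>F\<close> these are the basic open sets of a product of discrete
  spaces. The category notions are phrased through them and relative to a set \<open>C\<close>, so
  that spaces of trees can be treated as subsets without a topology of their own.\<close>

definition cyl :: "'i set \<Rightarrow> ('i \<Rightarrow> 'v) \<Rightarrow> ('i \<Rightarrow> 'v) set" where
  "cyl F x = {y. \<forall>i\<in>F. y i = x i}"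

definition cyl_closed :: "('i \<Rightarrow> 'v) set \<Rightarrow> bool" where
  "cyl_closed C \<longleftrightarrow> (\<forall>x. (\<forall>F. finite F \<longrightarrow> cyl F x \<inter> C \<noteq> {}) \<longrightarrow> x \<in> C)"

definition cyl_open :: "('i \<Rightarrow> 'v) set \<Rightarrow> bool" where
  "cyl_open U \<longleftrightarrow> (\<forall>x\<in>U. \<exists>F. finite F \<and> cyl F x \<subseteq> U)"

definition nowhere_dense_in :: "('i \<Rightarrow> 'v) set \<Rightarrow> ('i \<Rightarrow> 'v) set \<Rightarrow> bool" where
  "nowhere_dense_in C N \<longleftrightarrow>
     (\<forall>x\<in>C. \<forall>F. finite F \<longrightarrow> (\<exists>y\<in>C \<inter> cyl F x. \<exists>F'. finite F' \<and> cyl F' y \<inter> C \<inter> N = {}))"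

text \<open>\<open>M\<close> and the sets \<open>N n\<close> may stick out of \<open>C\<close>; only
  their traces on \<open>C\<close> count.\<close>

definition meager_in :: "('i \<Rightarrow> 'v) set \<Rightarrow> ('i \<Rightarrow> 'v) set \<Rightarrow> bool" where
  "meager_in C M \<longleftrightarrow> (\<exists>N :: nat \<Rightarrow> _. (\<forall>n. nowhere_dense_in C (N n)) \<and> M \<inter> C \<subseteq> (\<Union>n. N n))"

definition baire_property_in :: "('i \<Rightarrow> 'v) set \<Rightarrow> ('i \<Rightarrow> 'v) set \<Rightarrow> bool" where
  "baire_property_in C Y \<longleftrightarrow> (\<exists>U. cyl_open U \<and> meager_in C ((Y - U) \<union> (U - Y)))"

lemma cyl_self [simp]: "x \<in> cyl F x"
  by (simp add: cyl_def)

lemma cyl_Un: "cyl (F \<union> F') x = cyl F x \<inter> cyl F' x"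
  by (auto simp: cyl_def)

lemma cyl_eq: "y \<in> cyl F x \<Longrightarrow> cyl F y = cyl F x"
  by (auto simp: cyl_def)

lemma cyl_closedI:
  assumes "finite F" "\<And>x y. x \<in> C \<Longrightarrow> y \<in> cyl F x \<Longrightarrow> y \<in> C"
  shows "cyl_closed C"
  unfolding cyl_closed_def
proof (intro allI impI)
  fix x assume "\<forall>F. finite F \<longrightarrow> cyl F x \<inter> C \<noteq> {}"
  then obtain y where "y \<in> cyl F x" "y \<in> C" using assms(1) by blast
  then show "x \<in> C" using assms(2)[of y x] by (auto simp: cyl_def)
qed

lemma cyl_closed_cyl: "finite F \<Longrightarrow> cyl_closed (cyl F x)"
  by (rule cyl_closedI) (auto simp: cyl_def)

lemma cyl_closed_UNIV: "cyl_closed UNIV"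
  by (simp add: cyl_closed_def)

lemma cyl_closed_coordinate: "cyl_closed {x. Q (x i)}"
  by (rule cyl_closedI[of "{i}"]) (auto simp: cyl_def)

lemma cyl_closed_coordinate2: "cyl_closed {x. Q (x i) (x j)}"
  by (rule cyl_closedI[of "{i, j}"]) (auto simp: cyl_def)

lemma cyl_closed_INT:
  assumes "\<And>i. cyl_closed (A i)"
  shows "cyl_closed (\<Inter>i. A i)"
  unfolding cyl_closed_def
proof (intro allI impI INT_I)
  fix x i assume *: "\<forall>F. finite F \<longrightarrow> cyl F x \<inter> (\<Inter>i. A i) \<noteq> {}"
  have "cyl F x \<inter> A i \<noteq> {}" if "finite F" for F
    using *[rule_format, OF that] by auto
  then show "x \<in> A i" using assms[of i] by (simp add: cyl_closed_def)
qed

lemma cyl_closed_Int: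
  assumes "cyl_closed A" "cyl_closed B"
  shows "cyl_closed (A \<inter> B)"
proof -
  have "cyl_closed (\<Inter>b. if b then A else B)" by (rule cyl_closed_INT) (use assms in auto)
  moreover have "(\<Inter>b. if b then A else B) = A \<inter> B" by (auto split: if_splits)
  ultimately show ?thesis by simp
qed

lemma cyl_closed_conj: "cyl_closed {x. A x} \<Longrightarrow> cyl_closed {x. B x} \<Longrightarrow> cyl_closed {x. A x \<and> B x}"
  using cyl_closed_Int[of "{x. A x}" "{x. B x}"] by (simp add: Collect_conj_eq)

lemma cyl_closed_all: "(\<And>i. cyl_closed {x. A i x}) \<Longrightarrow> cyl_closed {x. \<forall>i. A i x}"
  using cyl_closed_INT[of "\<lambda>i. {x. A i x}"] by (simp add: Collect_all_eq)

section \<open>Meager sets and the Baire category theorem\<close>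

lemma meager_in_mono: "meager_in C M \<Longrightarrow> M' \<inter> C \<subseteq> M \<Longrightarrow> meager_in C M'"
  unfolding meager_in_def by blast

lemma nowhere_dense_imp_meager: "nowhere_dense_in C N \<Longrightarrow> meager_in C N"
  unfolding meager_in_def by (rule exI[of _ "\<lambda>_. N"]) auto

lemma meager_in_empty: "meager_in C {}"
  by (rule nowhere_dense_imp_meager) (auto simp: nowhere_dense_in_def)

lemma meager_in_UN:
  assumes "\<And>n :: nat. meager_in C (M n)"
  shows "meager_in C (\<Union>n. M n)"
proof -
  obtain N :: "nat \<Rightarrow> nat \<Rightarrow> _" where N: "\<And>n k. nowhere_dense_in C (N n k)" "\<And>n. M n \<inter> C \<subseteq> (\<Union>k. N n k)"
    using assms unfolding meager_in_def by metis
  have "(\<Union>n. M n) \<inter> C \<subseteq> (\<Union>j. case_prod N (prod_decode j))"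
  proof
    fix x assume "x \<in> (\<Union>n. M n) \<inter> C"
    then obtain n k where "x \<in> N n k" using N(2) by blast
    then show "x \<in> (\<Union>j. case_prod N (prod_decode j))"
      by (intro UN_I[of "prod_encode (n, k)"]) simp_all
  qed
  then show ?thesis
    unfolding meager_in_def using N(1)
    by (intro exI[of _ "\<lambda>j. case_prod N (prod_decode j)"]) (simp add: split_beta)
qed

lemma meager_in_Un:
  assumes "meager_in C M" "meager_in C M'"
  shows "meager_in C (M \<union> M')"
proof -
  have "meager_in C (\<Union>n :: nat. if n = 0 then M else M')"
    by (rule meager_in_UN) (use assms in auto)
  then show ?thesis by (rule meager_in_mono) (auto split: if_splits)
qed

lemma nowhere_dense_in_cyl:
  assumes "nowhere_dense_in C N" "finite F"
  shows "nowhere_dense_in (C \<inter> cyl F x) N"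
  unfolding nowhere_dense_in_def
proof (intro ballI allI impI)
  fix y F1 assume y: "y \<in> C \<inter> cyl F x" and F1: "finite (F1 :: 'a set)"
  then obtain w F' where w: "w \<in> C \<inter> cyl (F \<union> F1) y" "finite F'" "cyl F' w \<inter> C \<inter> N = {}"
    using assms unfolding nowhere_dense_in_def by (metis IntD1 finite_UnI)
  then have "w \<in> C \<inter> cyl F x \<inter> cyl F1 y" using y by (auto simp: cyl_def)
  then show "\<exists>w\<in>C \<inter> cyl F x \<inter> cyl F1 y. \<exists>F'. finite F' \<and> cyl F' w \<inter> (C \<inter> cyl F x) \<inter> N = {}"
    using w by blast
qed

lemma meager_in_cyl:
  assumes "meager_in C M" "finite F"
  shows "meager_in (C \<inter> cyl F x) M"
proof -
  obtain N :: "nat \<Rightarrow> _" where "\<And>n. nowhere_dense_in C (N n)" "M \<inter> C \<subseteq> (\<Union>n. N n)"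
    using assms(1) unfolding meager_in_def by blast
  then show ?thesis
    unfolding meager_in_def using assms(2)
    by (intro exI[of _ N]) (auto intro: nowhere_dense_in_cyl)
qed

text \<open>Resetting coordinate \<open>s\<close> from \<open>a\<close> to \<open>c\<close> is a
  homeomorphism onto \<open>C\<close>, because every point of \<open>C\<close> carries
  \<open>c\<close> at \<open>s\<close>. Later this moves meagerness from one label of an inner node
  to another.\<close>

lemma nowhere_dense_in_update:
  assumes N: "nowhere_dense_in C N" and C: "\<And>x. x \<in> C \<Longrightarrow> x s = c"
  shows "nowhere_dense_in {x. x s = a \<and> x(s := c) \<in> C} {x. x(s := c) \<in> N}"
  unfolding nowhere_dense_in_def
proof (intro ballI allI impI)
  fix x F assume x: "x \<in> {x. x s = a \<and> x(s := c) \<in> C}" and F: "finite (F :: 'a set)"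
  then obtain y F' where y: "y \<in> C" "y \<in> cyl F (x(s := c))" "finite F'" "cyl F' y \<inter> C \<inter> N = {}"
    using N unfolding nowhere_dense_in_def by blast
  have ys: "y s = c" using C y by blast
  then have 1: "(y(s := a))(s := c) = y" by auto
  have "y(s := a) \<in> cyl F x" using y(2) x by (auto simp: cyl_def)
  moreover have "w(s := c) \<in> cyl F' y" if "w \<in> cyl F' (y(s := a))" for w
    using that ys by (auto simp: cyl_def split: if_splits)
  then have "cyl F' (y(s := a)) \<inter> {x. x s = a \<and> x(s := c) \<in> C} \<inter> {x. x(s := c) \<in> N} = {}"
    using y(4) by blast
  ultimately show "\<exists>y\<in>{x. x s = a \<and> x(s := c) \<in> C} \<inter> cyl F x. \<exists>F'. finite F' \<and>
     cyl F' y \<inter> {x. x s = a \<and> x(s := c) \<in> C} \<inter> {x. x(s := c) \<in> N} = {}"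
    using y(1,3) 1 by (intro bexI[of _ "y(s := a)"]) auto
qed

lemma meager_in_update:
  assumes "meager_in C M" and C: "\<And>x. x \<in> C \<Longrightarrow> x s = c"
  shows "meager_in {x. x s = a \<and> x(s := c) \<in> C} {x. x(s := c) \<in> M}"
proof -
  obtain N :: "nat \<Rightarrow> _" where "\<And>n. nowhere_dense_in C (N n)" "M \<inter> C \<subseteq> (\<Union>n. N n)"
    using assms(1) unfolding meager_in_def by blast
  moreover then have "nowhere_dense_in {x. x s = a \<and> x(s := c) \<in> C} {x. x(s := c) \<in> N n}" for n
    using C by (intro nowhere_dense_in_update)
  ultimately show ?thesis
    unfolding meager_in_def by (intro exI[of _ "\<lambda>n. {x. x(s := c) \<in> N n}"]) auto
qed

text \<open>The Baire category theorem: closed subsets of a countable product of discrete spaces are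
  complete, so a limit point of \<open>C\<close> outside all \<open>N n\<close> can be built by
  successive approximation.\<close>

theorem cyl_closed_not_meager:
  fixes C :: "('i :: countable \<Rightarrow> 'v) set"
  assumes C: "cyl_closed C" "C \<noteq> {}"
  shows "\<not> meager_in C C"
proof
  assume "meager_in C C"
  then obtain N :: "nat \<Rightarrow> _" where N: "\<And>n. nowhere_dense_in C (N n)" "C \<subseteq> (\<Union>n. N n)"
    unfolding meager_in_def by blast
  have "\<exists>p :: nat \<Rightarrow> ('i \<Rightarrow> 'v) \<times> 'i set. \<forall>n. (fst (p n) \<in> C \<and> finite (snd (p n))) \<and>
     (fst (p (Suc n)) \<in> cyl (snd (p n)) (fst (p n)) \<and> snd (p n) \<subseteq> snd (p (Suc n)) \<and>
      {t. to_nat t = n} \<subseteq> snd (p (Suc n)) \<and> cyl (snd (p (Suc n))) (fst (p (Suc n))) \<inter> C \<inter> N n = {})"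
  proof (rule dependent_nat_choice)
    show "\<exists>q :: ('i \<Rightarrow> 'v) \<times> 'i set. fst q \<in> C \<and> finite (snd q)"
      using C(2) by (metis all_not_in_conv finite.emptyI fst_conv snd_conv)
  next
    fix q :: "('i \<Rightarrow> 'v) \<times> 'i set" and n :: nat
    assume q: "fst q \<in> C \<and> finite (snd q)"
    then obtain y F' where y: "y \<in> C \<inter> cyl (snd q) (fst q)" "finite F'" "cyl F' y \<inter> C \<inter> N n = {}"
      using N(1) unfolding nowhere_dense_in_def by blast
    have "{t :: 'i. to_nat t = n} \<subseteq> {from_nat n}" by auto
    then have "finite {t :: 'i. to_nat t = n}" by (rule finite_subset) auto
    then show "\<exists>q'. (fst q' \<in> C \<and> finite (snd q')) \<and> (fst q' \<in> cyl (snd q) (fst q) \<and>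
        snd q \<subseteq> snd q' \<and> {t. to_nat t = n} \<subseteq> snd q' \<and> cyl (snd q') (fst q') \<inter> C \<inter> N n = {})"
      using y q by (intro exI[of _ "(y, F' \<union> snd q \<union> {t. to_nat t = n})"]) (auto simp: cyl_Un)
  qed
  then obtain p :: "nat \<Rightarrow> ('i \<Rightarrow> 'v) \<times> 'i set" where
    p': "\<forall>n. (fst (p n) \<in> C \<and> finite (snd (p n))) \<and>
      (fst (p (Suc n)) \<in> cyl (snd (p n)) (fst (p n)) \<and> snd (p n) \<subseteq> snd (p (Suc n)) \<and>
      {t. to_nat t = n} \<subseteq> snd (p (Suc n)) \<and> cyl (snd (p (Suc n))) (fst (p (Suc n))) \<inter> C \<inter> N n = {})"
    by (elim exE) (rule that)
  then have p: "fst (p n) \<in> C" "finite (snd (p n))"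
    "fst (p (Suc n)) \<in> cyl (snd (p n)) (fst (p n))" "snd (p n) \<subseteq> snd (p (Suc n))"
    "{t. to_nat t = n} \<subseteq> snd (p (Suc n))"
    "cyl (snd (p (Suc n))) (fst (p (Suc n))) \<inter> C \<inter> N n = {}" for n
    by simp_all
  have mono: "snd (p m) \<subseteq> snd (p n)" if "m \<le> n" for m n
    using lift_Suc_mono_le[of "\<lambda>n. snd (p n)" m n] p(4) that by simp
  have const: "fst (p n) t = fst (p m) t" if "m \<le> n" "t \<in> snd (p m)" for m n t
    using that(1)
  proof (induction rule: dec_induct)
    case (step k)
    then have "t \<in> snd (p k)" using mono[of m k] that(2) by blast
    then show ?case using p(3)[of k] step by (auto simp: cyl_def)
  qed simp
  \<comment> \<open>Coordinate \<open>t\<close> is frozen from stage \<open>Suc (to_nat t)\<close>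
    on, so this diagonal point agrees with every stage on its frozen set.\<close>
  define z where "z t = fst (p (Suc (to_nat t))) t" for t
  have tin: "t \<in> snd (p (Suc (to_nat t)))" for t using p(5) by blast
  have z: "z \<in> cyl (snd (p n)) (fst (p n))" for n
    unfolding cyl_def z_def
  proof (clarsimp)
    fix t assume "t \<in> snd (p n)"
    then show "fst (p (Suc (to_nat t))) t = fst (p n) t"
      using const[of n "Suc (to_nat t)" t] const[of "Suc (to_nat t)" n t] tin[of t]
      by (metis nle_le)
  qed
  have "z \<in> C"
  proof (rule C(1)[unfolded cyl_closed_def, rule_format])
    fix F :: "'i set" assume F: "finite F"
    define n where "n = Suc (Max (insert 0 (to_nat ` F)))"
    have "F \<subseteq> snd (p n)"
    proof
      fix t assume "t \<in> F"
      then have "Suc (to_nat t) \<le> n" unfolding n_def using F by simp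
      then show "t \<in> snd (p n)" using mono tin by blast
    qed
    then have "fst (p n) \<in> cyl F z" using z[of n] by (auto simp: cyl_def)
    then show "cyl F z \<inter> C \<noteq> {}" using p(1) by blast
  qed
  then obtain n where "z \<in> N n" using N(2) by blast
  then show False using p(6)[of n] z[of "Suc n"] \<open>z \<in> C\<close> by blast
qed

section \<open>The Baire property\<close>

lemma baire_property_open: "cyl_open U \<Longrightarrow> baire_property_in C U"
  unfolding baire_property_in_def
  by (intro exI[of _ U] conjI nowhere_dense_imp_meager) (auto simp: nowhere_dense_in_def)

text \<open>\<open>V\<close> is the exterior of \<open>U\<close> relative to \<open>C\<close>.
  Outside \<open>U\<close> and \<open>V\<close> only the boundary of \<open>U\<close> is left, which
  is nowhere dense, so \<open>V\<close> approximates the complement of \<open>Y\<close>.\<close>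

lemma baire_property_Compl:
  assumes "baire_property_in C Y"
  shows "baire_property_in C (- Y)"
proof -
  obtain U where U: "cyl_open U" "meager_in C ((Y - U) \<union> (U - Y))"
    using assms unfolding baire_property_in_def by blast
  define V where "V = {x. \<exists>F. finite F \<and> cyl F x \<inter> C \<inter> U = {}}"
  have V: "cyl F x \<subseteq> V" if "finite F" "cyl F x \<inter> C \<inter> U = {}" for F x
    unfolding V_def using that cyl_eq by blast
  then have "cyl_open V" unfolding cyl_open_def V_def by blast
  moreover have "nowhere_dense_in C (- U - V)"
    unfolding nowhere_dense_in_def
  proof (intro ballI allI impI)
    fix x F assume x: "x \<in> C" and F: "finite (F :: 'a set)"
    show "\<exists>y\<in>C \<inter> cyl F x. \<exists>F'. finite F' \<and> cyl F' y \<inter> C \<inter> (- U - V) = {}"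
    proof (cases "cyl F x \<inter> C \<inter> U = {}")
      case True
      then show ?thesis using V[OF F True] x F by (intro bexI[of _ x] exI[of _ F]) auto
    next
      case False
      then obtain y where "y \<in> cyl F x \<inter> C \<inter> U" by blast
      moreover then obtain F' where "finite F'" "cyl F' y \<subseteq> U" using U(1) unfolding cyl_open_def by blast
      ultimately show ?thesis by blast
    qed
  qed
  then have "meager_in C ((Y - U) \<union> (U - Y) \<union> (- U - V))"
    using U(2) meager_in_Un nowhere_dense_imp_meager by blast
  then have "meager_in C ((- Y - V) \<union> (V - - Y))"
  proof (rule meager_in_mono)
    have "U \<inter> V \<inter> C = {}" unfolding V_def using cyl_self by blast
    then show "(- Y - V \<union> (V - - Y)) \<inter> C \<subseteq> Y - U \<union> (U - Y) \<union> (- U - V)" by blast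
  qed
  ultimately show ?thesis unfolding baire_property_in_def by blast
qed

lemma baire_property_UN:
  assumes "\<And>n :: nat. baire_property_in C (Y n)"
  shows "baire_property_in C (\<Union>n. Y n)"
proof -
  have "\<forall>n. \<exists>U. cyl_open U \<and> meager_in C ((Y n - U) \<union> (U - Y n))"
    using assms unfolding baire_property_in_def by simp
  from choice[OF this] obtain U where
    "\<forall>n. cyl_open (U n) \<and> meager_in C ((Y n - U n) \<union> (U n - Y n))" ..
  then have U: "cyl_open (U n)" "meager_in C ((Y n - U n) \<union> (U n - Y n))" for n
    by simp_all
  have "cyl_open (\<Union>n. U n)"
    unfolding cyl_open_def by (metis U(1)[unfolded cyl_open_def] UN_iff UN_upper UNIV_I order_trans)
  moreover have "meager_in C ((\<Union>n. Y n) - (\<Union>n. U n) \<union> ((\<Union>n. U n) - (\<Union>n. Y n)))"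
    by (rule meager_in_mono[OF meager_in_UN[of C "\<lambda>n. (Y n - U n) \<union> (U n - Y n)"]]) (use U(2) in auto)
  ultimately show ?thesis unfolding baire_property_in_def by blast
qed

text \<open>The open set approximating \<open>Y\<close> either misses a basic open part of
  \<open>C\<close>, on which \<open>Y\<close> is then meager, or it is dense in \<open>C\<close> and
  its complement is nowhere dense.\<close>

lemma baire_property_dichotomy:
  assumes "baire_property_in C Y"
  shows "meager_in C (- Y) \<or> (\<exists>x\<in>C. \<exists>F. finite F \<and> meager_in (C \<inter> cyl F x) Y)"
proof -
  obtain U where U: "cyl_open U" "meager_in C ((Y - U) \<union> (U - Y))"
    using assms unfolding baire_property_in_def by blast
  show ?thesis
  proof (cases "\<exists>x\<in>C. \<exists>F. finite F \<and> cyl F x \<inter> C \<inter> U = {}")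
    case True
    then obtain x F where x: "x \<in> C" "finite F" "cyl F x \<inter> C \<inter> U = {}" by blast
    have "meager_in (C \<inter> cyl F x) Y"
      by (rule meager_in_mono[OF meager_in_cyl[OF U(2) x(2)]]) (use x(3) in blast)
    then show ?thesis using x by blast
  next
    case False
    have "nowhere_dense_in C (- U)"
      unfolding nowhere_dense_in_def
    proof (intro ballI allI impI)
      fix x F assume x: "x \<in> C" and F: "finite (F :: 'a set)"
      then obtain y where y: "y \<in> cyl F x \<inter> C \<inter> U" using False by blast
      moreover then obtain F' where "finite F'" "cyl F' y \<subseteq> U" using U(1) unfolding cyl_open_def by blast
      ultimately show "\<exists>y\<in>C \<inter> cyl F x. \<exists>F'. finite F' \<and> cyl F' y \<inter> C \<inter> - U = {}" by blast
    qed
    then have "meager_in C ((Y - U) \<union> (U - Y) \<union> - U)"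
      using U(2) meager_in_Un nowhere_dense_imp_meager by blast
    then have "meager_in C (- Y)" by (rule meager_in_mono) blast
    then show ?thesis ..
  qed
qed

section \<open>Trees with truth values\<close>

text \<open>Being inductive, the type contains only well-founded trees. Besides shaping the trees,
  it later measures Borel sets, in place of countable ordinals.\<close>

datatype shape = Leaf | Node "nat \<Rightarrow> shape"

text \<open>
  Labels of tree nodes: 0 is an inner node that is true, 1 a false leaf, 2 a true leaf, and
  \<open>n + 3\<close> an inner node that is false because its child \<open>n\<close> is true. Positions below a leaf are
  padded with 1.
\<close>

definition is_true :: "nat \<Rightarrow> bool" where
  "is_true k \<longleftrightarrow> k = 0 \<or> k = 2"

definition blur :: "nat \<Rightarrow> nat" where
  "blur k = (if k < 3 then k else 0)"

text \<open>A false inner node must have exactly one true child, not just some true child: then its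
  label is determined by the truth values of its children, which makes evidence unique.\<close>

definition locally_valid :: "nat list \<Rightarrow> (nat list \<Rightarrow> nat) \<Rightarrow> bool" where
  "locally_valid s x \<longleftrightarrow> (x s = 0 \<longrightarrow> (\<forall>i. \<not> is_true (x (s @ [i])))) \<and>
     (\<forall>n. x s = n + 3 \<longrightarrow> is_true (x (s @ [n])) \<and> (\<forall>i. i \<noteq> n \<longrightarrow> \<not> is_true (x (s @ [i]))))"

definition valid_below :: "nat list \<Rightarrow> (nat list \<Rightarrow> nat) \<Rightarrow> bool" where
  "valid_below s x \<longleftrightarrow> (\<forall>t. locally_valid (s @ t) x)"

primrec has_shape :: "shape \<Rightarrow> nat list \<Rightarrow> (nat list \<Rightarrow> nat) \<Rightarrow> bool" where
  "has_shape Leaf s x \<longleftrightarrow> (x s = 1 \<or> x s = 2) \<and> (\<forall>t. t \<noteq> [] \<longrightarrow> x (s @ t) = 1)"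
| "has_shape (Node b) s x \<longleftrightarrow> x s \<noteq> 1 \<and> x s \<noteq> 2 \<and> locally_valid s x \<and> (\<forall>i. has_shape (b i) (s @ [i]) x)"

definition subtree :: "nat list \<Rightarrow> nat list set" where
  "subtree s = {s @ t | t. True}"

lemma in_subtree: "t \<in> subtree s \<longleftrightarrow> (\<exists>u. t = s @ u)"
  by (auto simp: subtree_def)

lemma self_in_subtree [simp]: "s \<in> subtree s"
  by (simp add: in_subtree)

lemma append_in_subtree [simp]: "s @ t \<in> subtree s"
  by (auto simp: in_subtree)

lemma subtree_trans: "t \<in> subtree s \<Longrightarrow> subtree t \<subseteq> subtree s"
  by (auto simp: in_subtree)

lemma subtree_cases:
  assumes "t \<in> subtree s"
  obtains "t = s" | i where "t \<in> subtree (s @ [i])"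
proof -
  obtain u where "t = s @ u" using assms by (auto simp: in_subtree)
  then show ?thesis by (cases u) (auto simp: in_subtree intro: that)
qed

lemma child_disjoint: "t \<in> subtree (s @ [i]) \<Longrightarrow> t \<in> subtree (s @ [j]) \<Longrightarrow> i = j"
  by (auto simp: in_subtree)

lemma parent_notin: "s \<notin> subtree (s @ [i])"
  by (auto simp: in_subtree)

lemma blur_cong:
  "blur k = blur l \<Longrightarrow> k = 1 \<or> k = 2 \<Longrightarrow> l = k"
  by (auto simp: blur_def split: if_splits)

lemma blur_blur [simp]: "blur (blur k) = blur k"
  by (simp add: blur_def)

lemma blur_simps [simp]: "blur 0 = 0" "blur (n + 3) = 0"
  by (simp_all add: blur_def)

lemma has_shape_cong:
  "(\<And>t. t \<in> subtree s \<Longrightarrow> x t = y t) \<Longrightarrow> has_shape b s x \<longleftrightarrow> has_shape b s y"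
proof (induction b arbitrary: s)
  case Leaf
  then show ?case by simp
next
  case (Node b)
  have "has_shape (b i) (s @ [i]) x \<longleftrightarrow> has_shape (b i) (s @ [i]) y" for i
    by (rule Node.IH) (use Node.prems subtree_trans[of "s @ [i]" s] in auto)
  moreover have "locally_valid s x \<longleftrightarrow> locally_valid s y"
    unfolding locally_valid_def using Node.prems by simp
  ultimately show ?case using Node.prems[of s] by simp
qed

lemma has_shape_valid: "has_shape b s x \<Longrightarrow> valid_below s x"
proof (induction b arbitrary: s)
  case Leaf
  then have "x (s @ t) = 1 \<or> x (s @ t) = 2" for t by (cases t) auto
  then have "x (s @ t) \<noteq> 0 \<and> x (s @ t) \<noteq> n + 3" for t n
    using \<open>\<And>t. x (s @ t) = 1 \<or> x (s @ t) = 2\<close>[of t] by linarith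
  then have "locally_valid (s @ t) x" for t
    unfolding locally_valid_def by blast
  then show ?case by (simp add: valid_below_def)
next
  case (Node b)
  show ?case
    unfolding valid_below_def
  proof
    fix t show "locally_valid (s @ t) x"
    proof (cases t)
      case Nil
      then show ?thesis using Node.prems by simp
    next
      case (Cons i u)
      have "valid_below (s @ [i]) x" using Node by auto
      then show ?thesis unfolding Cons valid_below_def by (metis append.assoc append_Cons append_Nil)
    qed
  qed
qed

text \<open>Blurring keeps leaf labels, and the labels of the children determine that of an inner
  node, so induction on the shape recovers everything. \<open>y\<close> is merely valid because it
  will come from an arbitrary point of the space.\<close>

lemma has_shape_unique:
  assumes "has_shape b s x" "valid_below s y" "\<And>t. t \<in> subtree s \<Longrightarrow> blur (x t) = blur (y t)"
    and "t \<in> subtree s"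
  shows "y t = x t"
  using assms
proof (induction b arbitrary: s t)
  case Leaf
  obtain u where "t = s @ u" using Leaf.prems(4) by (auto simp: in_subtree)
  then have "x t = 1 \<or> x t = 2" using Leaf.prems(1) by (cases u) auto
  then show ?case using blur_cong Leaf.prems(3,4) by blast
next
  case (Node b)
  have IH: "y t = x t" if "t \<in> subtree (s @ [i])" for t i
  proof (rule Node.IH[OF rangeI _ _ _ that])
    show "valid_below (s @ [i]) y" using Node.prems(2) by (simp add: valid_below_def)
    show "blur (x u) = blur (y u)" if "u \<in> subtree (s @ [i])" for u
      using that Node.prems(3) subtree_trans[of "s @ [i]" s] by auto
  qed (use Node.prems(1) in auto)
  from Node.prems(4) show ?case
  proof (cases rule: subtree_cases)
    case 1
    have x: "x s \<noteq> 1" "x s \<noteq> 2" "locally_valid s x" using Node.prems(1) by auto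
    moreover have "y s \<noteq> 1" "y s \<noteq> 2" using x(1,2) blur_cong[OF Node.prems(3)[of s, symmetric]] by auto
    moreover have "locally_valid s y" using Node.prems(2) unfolding valid_below_def by (metis append_Nil2)
    moreover have "y (s @ [i]) = x (s @ [i])" for i by (rule IH[of _ i]) simp
    ultimately have sim: "y (s @ [i]) = x (s @ [i])" "locally_valid s y" "y s \<noteq> 1" "y s \<noteq> 2" for i
      by simp_all
    have k: "k = 0 \<or> (\<exists>n. k = n + 3)" if "k \<noteq> 1" "k \<noteq> 2" for k :: nat
      using that by presburger
    from k[OF x(1,2)] show ?thesis
    proof (elim disjE exE)
      assume "x s = 0"
      then have "\<not> is_true (x (s @ [i]))" for i using x(3) by (simp add: locally_valid_def)
      then have "y s \<noteq> n + 3" for n using sim(1,2) by (auto simp: locally_valid_def)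
      then show "y t = x t" using k[OF sim(3,4)] 1 \<open>x s = 0\<close> by auto
    next
      fix n assume n: "x s = n + 3"
      then have is_true: "is_true (x (s @ [i])) \<longleftrightarrow> i = n" for i
        using x(3) by (auto simp: locally_valid_def)
      then have "y s \<noteq> 0" using sim(1,2) by (auto simp: locally_valid_def)
      then obtain m where m: "y s = m + 3" using k[OF sim(3,4)] by auto
      then have "is_true (x (s @ [m]))" using sim(1,2) by (auto simp: locally_valid_def)
      then show "y t = x t" using is_true m n 1 by simp
    qed
  qed (rule IH)
qed

lemma cyl_closed_locally_valid: "cyl_closed {x. locally_valid s x}"
proof -
  \<comment> \<open>Rearranged so that each \<open>i\<close> constrains just the two coordinates
    \<open>s\<close> and \<open>s @ [i]\<close>, which is a closed condition. The subtraction is not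
    truncated since \<open>x s\<close> is at least 3.\<close>
  have "locally_valid s x \<longleftrightarrow> (\<forall>i. (x s = 0 \<longrightarrow> \<not> is_true (x (s @ [i]))) \<and>
      (x s \<ge> 3 \<longrightarrow> (is_true (x (s @ [i])) \<longleftrightarrow> i = x s - 3)))" for x
    unfolding locally_valid_def by (metis add_diff_cancel_right' le_add2 le_add_diff_inverse2)
  moreover have "cyl_closed {x. \<forall>i. (x s = 0 \<longrightarrow> \<not> is_true (x (s @ [i]))) \<and>
      (x s \<ge> 3 \<longrightarrow> (is_true (x (s @ [i])) \<longleftrightarrow> i = x s - 3))}"
    by (rule cyl_closed_all, rule cyl_closed_coordinate2[of
      "\<lambda>k l. (k = 0 \<longrightarrow> \<not> is_true l) \<and> (k \<ge> 3 \<longrightarrow> (is_true l \<longleftrightarrow> i = k - 3))" for i])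
  ultimately show ?thesis by simp
qed

lemma cyl_closed_has_shape: "cyl_closed {x. has_shape b s x}"
proof (induction b arbitrary: s)
  case Leaf
  have "cyl_closed {x :: nat list \<Rightarrow> nat. x s = 1 \<or> x s = 2}"
    by (rule cyl_closed_coordinate[of "\<lambda>k. k = 1 \<or> k = 2"])
  moreover have "cyl_closed {x :: nat list \<Rightarrow> nat. \<forall>t. t \<noteq> [] \<longrightarrow> x (s @ t) = 1}"
    by (rule cyl_closed_all, rule cyl_closed_coordinate[of "\<lambda>k. t \<noteq> [] \<longrightarrow> k = 1" for t])
  ultimately have "cyl_closed {x :: nat list \<Rightarrow> nat. (x s = 1 \<or> x s = 2) \<and> (\<forall>t. t \<noteq> [] \<longrightarrow> x (s @ t) = 1)}"
    by (rule cyl_closed_conj)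
  then show ?case by simp
next
  case (Node b)
  have "cyl_closed {x :: nat list \<Rightarrow> nat. x s \<noteq> 1}" "cyl_closed {x :: nat list \<Rightarrow> nat. x s \<noteq> 2}"
    by (rule cyl_closed_coordinate[of "\<lambda>k. k \<noteq> _"])+
  moreover have "cyl_closed {x. \<forall>i. has_shape (b i) (s @ [i]) x}"
    by (rule cyl_closed_all) (rule Node[OF rangeI])
  ultimately show ?case
    unfolding has_shape.simps using cyl_closed_locally_valid[of s] by (simp add: cyl_closed_conj)
qed

text \<open>A true node is obtained from false trees at all children, a false node by making child 0
  the only true one.\<close>

lemma exists_has_shape: "(\<exists>x. has_shape b s x \<and> is_true (x s)) \<and> (\<exists>x. has_shape b s x \<and> \<not> is_true (x s))"
proof (induction b arbitrary: s)
  case Leaf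
  have "has_shape Leaf s (\<lambda>t. if t = s then 2 else 1)" "has_shape Leaf s (\<lambda>t. 1)" by auto
  then show ?case
    using exI[of "\<lambda>x. has_shape Leaf s x \<and> is_true (x s)" "\<lambda>t. if t = s then 2 else 1"]
      exI[of "\<lambda>x. has_shape Leaf s x \<and> \<not> is_true (x s)" "\<lambda>t. 1"]
    unfolding is_true_def by simp
next
  case (Node b)
  note IH = Node[OF rangeI]
  have "\<forall>i. \<exists>x. has_shape (b i) (s @ [i]) x \<and> \<not> is_true (x (s @ [i]))"
    using IH by simp
  from choice[OF this] obtain f where
    f: "\<forall>i. has_shape (b i) (s @ [i]) (f i) \<and> \<not> is_true (f i (s @ [i]))" ..
  obtain g where g: "has_shape (b 0) (s @ [0]) g" "is_true (g (s @ [0]))"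
    using IH[of 0 "s @ [0]"] by blast
  \<comment> \<open>For \<open>t\<close> strictly below \<open>s\<close>, the entry
    \<open>t ! length s\<close> is the child of \<open>s\<close> through which \<open>t\<close>
    passes, so \<open>glue\<close> puts the tree \<open>h i\<close> at child
    \<open>i\<close>.\<close>
  define glue where "glue k h t = (if t = s then k else h (t ! length s) t)"
    for k :: nat and h :: "nat \<Rightarrow> nat list \<Rightarrow> nat" and t
  have glue: "glue k h t = h i t" if "t \<in> subtree (s @ [i])" for k h i t
    using that by (auto simp: glue_def in_subtree nth_append)
  then have shape: "has_shape (b i) (s @ [i]) (glue k h) = has_shape (b i) (s @ [i]) (h i)" for k h i
    by (intro has_shape_cong)
  have glue_root: "glue k h s = k" "glue k h (s @ [i]) = h i (s @ [i])" for k h i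
    using glue[of "s @ [i]" i] by (simp_all add: glue_def)
  have "has_shape (Node b) s (glue 0 f) \<and> is_true (glue 0 f s)"
    using f by (simp add: shape locally_valid_def glue_root) (simp add: is_true_def)
  moreover have "has_shape (Node b) s (glue 3 (f(0 := g))) \<and> \<not> is_true (glue 3 (f(0 := g)) s)"
    using f g by (simp add: shape locally_valid_def glue_root) (simp add: is_true_def)
  ultimately show ?case by blast
qed

definition true_trees :: "shape \<Rightarrow> nat list \<Rightarrow> (nat list \<Rightarrow> nat) set" where
  "true_trees b s = {x. has_shape b s x \<and> is_true (x s)}"

definition false_trees :: "shape \<Rightarrow> nat list \<Rightarrow> (nat list \<Rightarrow> nat) set" where
  "false_trees b s = {x. has_shape b s x \<and> \<not> is_true (x s)}"

lemma cyl_closed_true_trees: "cyl_closed (true_trees b s)"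
  unfolding true_trees_def
  using cyl_closed_conj[OF cyl_closed_has_shape[of b s] cyl_closed_coordinate[of is_true s]] by simp

lemma cyl_closed_false_trees: "cyl_closed (false_trees b s)"
  unfolding false_trees_def
  using cyl_closed_conj[OF cyl_closed_has_shape[of b s] cyl_closed_coordinate[of "\<lambda>k. \<not> is_true k" s]] by simp

definition independent_of :: "nat list set \<Rightarrow> (nat list \<Rightarrow> nat) set \<Rightarrow> bool" where
  "independent_of T K \<longleftrightarrow> (\<forall>x y. (\<forall>t. t \<notin> T \<longrightarrow> x t = y t) \<longrightarrow> x \<in> K \<longrightarrow> y \<in> K)"

lemma independent_of_true_trees:
  assumes "x \<in> K" "independent_of (subtree s) K"
  shows "\<exists>y \<in> K \<inter> true_trees b s. \<forall>t. t \<notin> subtree s \<longrightarrow> y t = x t"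
proof -
  obtain z where z: "has_shape b s z" "is_true (z s)" using exists_has_shape by blast
  define y where "y t = (if t \<in> subtree s then z t else x t)" for t
  have "y \<in> K"
    by (rule assms(2)[unfolded independent_of_def, rule_format, OF _ assms(1)]) (simp add: y_def)
  moreover have "has_shape b s y" using z(1) has_shape_cong[of s y z] by (simp add: y_def)
  ultimately show ?thesis using z(2) by (intro bexI[of _ y]) (auto simp: true_trees_def y_def)
qed

section \<open>Borel sets measured by tree shapes\<close>

text \<open>\<open>H\<close> is the set of hidden positions, at which only the blurred label can be
  seen; \<open>view_open\<close> is openness in the resulting coarser topology.\<close>

definition view :: "nat list set \<Rightarrow> nat list \<Rightarrow> nat \<Rightarrow> nat" where
  "view H t k = (if t \<in> H then blur k else k)"

definition view_open :: "nat list set \<Rightarrow> (nat list \<Rightarrow> nat) set \<Rightarrow> bool" where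
  "view_open H Y \<longleftrightarrow> (\<forall>x\<in>Y. \<exists>F. finite F \<and> (\<forall>y. (\<forall>t\<in>F. view H t (y t) = view H t (x t)) \<longrightarrow> y \<in> Y))"

text \<open>The shape acts as a bound on Borel rank: children bound the complements of the sets in
  the union. Each complement needs a suitable child at arbitrarily large \<open>i\<close>, because
  the transfer below must choose a child that avoids a given finite set of positions.\<close>

inductive borel_rank :: "nat list set \<Rightarrow> shape \<Rightarrow> (nat list \<Rightarrow> nat) set \<Rightarrow> bool" for H where
  view_open: "view_open H Y \<Longrightarrow> borel_rank H (Node b) Y"
| UN_Compl: "(\<And>k m. \<exists>i\<ge>m. borel_rank H (b i) (- Y k)) \<Longrightarrow> borel_rank H (Node b) (\<Union>k :: nat. Y k)"

lemma borel_rank_view: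
  "borel_rank H b Y \<Longrightarrow> (\<And>t. view H t (x t) = view H t (y t)) \<Longrightarrow> x \<in> Y \<longleftrightarrow> y \<in> Y"
proof (induction rule: borel_rank.induct)
  case (view_open Y b)
  then show ?case unfolding view_open_def by metis
next
  case (UN_Compl b Y)
  then have "x \<in> - Y k \<longleftrightarrow> y \<in> - Y k" for k by blast
  then show ?case by auto
qed

lemma borel_rank_baire_property: "borel_rank H b Y \<Longrightarrow> baire_property_in C Y"
proof (induction rule: borel_rank.induct)
  case (view_open Y b)
  have "cyl_open Y"
    unfolding cyl_open_def
  proof
    fix x assume "x \<in> Y"
    then obtain F where "finite F" "\<And>y. (\<forall>t\<in>F. view H t (y t) = view H t (x t)) \<Longrightarrow> y \<in> Y"
      using view_open unfolding view_open_def by blast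
    then show "\<exists>F. finite F \<and> cyl F x \<subseteq> Y" by (intro exI[of _ F]) (auto simp: cyl_def)
  qed
  then show ?case by (rule baire_property_open)
next
  case (UN_Compl b Y)
  then have "baire_property_in C (- (- Y k))" for k by (blast intro: baire_property_Compl)
  then show ?case by (intro baire_property_UN) simp
qed

lemma borel_rank_Compl: "borel_rank H b Y \<Longrightarrow> borel_rank H (Node (\<lambda>_. b)) (- Y)"
  using borel_rank.UN_Compl[of H "\<lambda>_. b" "\<lambda>_. - Y"] by auto

lemma borel_rank_UN:
  fixes Y :: "nat \<Rightarrow> (nat list \<Rightarrow> nat) set"
  assumes "\<And>k. borel_rank H (b k) (Y k)"
  shows "\<exists>b. borel_rank H b (\<Union>k. Y k)"
proof
  \<comment> \<open>Every \<open>k\<close> is the first component of infinitely many codes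
    \<open>i\<close>. The inner \<open>Node\<close> accounts for passing from \<open>Y k\<close> to
    its complement.\<close>
  show "borel_rank H (Node (\<lambda>i. Node (\<lambda>_. b (fst (prod_decode i))))) (\<Union>k. Y k)"
  proof (rule borel_rank.UN_Compl)
    fix k m
    show "\<exists>i\<ge>m. borel_rank H (Node (\<lambda>_. b (fst (prod_decode i)))) (- Y k)"
      using borel_rank_Compl[OF assms[of k]]
      by (intro exI[of _ "prod_encode (k, m)"]) (simp add: le_prod_encode_2)
  qed
qed

lemma borel_rank_weaken:
  assumes "borel_rank H (Node b) Y" "\<And>i m. \<exists>j\<ge>m. b' j = b i" 
  shows "borel_rank H (Node b') Y"
  using assms(1)
proof cases
  case view_open
  then show ?thesis by (rule borel_rank.view_open)
next
  case (UN_Compl Y')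
  then show ?thesis using assms(2) by (metis borel_rank.UN_Compl)
qed

lemma borel_rank_common:
  assumes "borel_rank H b Y" "borel_rank H' b' Y'"
  shows "\<exists>c. borel_rank H c Y \<and> borel_rank H' c Y'"
proof -
  obtain f where f: "b = Node f" using assms(1) by cases
  obtain g where g: "b' = Node g" using assms(2) by cases
  \<comment> \<open>A code stands for \<open>(j, (l, m))\<close>: \<open>j\<close> chooses between
    \<open>f\<close> and \<open>g\<close>, \<open>l\<close> is the index there, and the free
    \<open>m\<close> makes each entry recur infinitely often.\<close>
  define h where "h i = (let (j, k) = prod_decode i; l = fst (prod_decode k) in
    if j = 0 then f l else g l)" for i
  have "h (prod_encode (0, prod_encode (i, m))) = f i" "h (prod_encode (1, prod_encode (i, m))) = g i" for i m
    by (simp_all add: h_def)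
  moreover have "m \<le> prod_encode (j, prod_encode (i, m))" for i j m
    using le_prod_encode_2[of "prod_encode (i, m)" j] le_prod_encode_2[of m i] by linarith
  ultimately have "borel_rank H (Node h) Y" "borel_rank H' (Node h) Y'"
    using assms unfolding f g by (blast intro: borel_rank_weaken)+
  then show ?thesis by blast
qed

section \<open>True and false trees, and transfer between them\<close>

lemma true_trees_cong:
  assumes "\<And>t. t \<in> subtree s \<Longrightarrow> x t = y t"
  shows "x \<in> true_trees b s \<longleftrightarrow> y \<in> true_trees b s"
  using has_shape_cong[of s x y b] assms by (simp add: true_trees_def)

lemma false_trees_cong:
  assumes "\<And>t. t \<in> subtree s \<Longrightarrow> x t = y t"
  shows "x \<in> false_trees b s \<longleftrightarrow> y \<in> false_trees b s"
  using has_shape_cong[of s x y b] assms by (simp add: false_trees_def)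

lemma trees_update [simp]:
  "x(s := k) \<in> true_trees b (s @ [i]) \<longleftrightarrow> x \<in> true_trees b (s @ [i])"
  "x(s := k) \<in> false_trees b (s @ [i]) \<longleftrightarrow> x \<in> false_trees b (s @ [i])"
  using parent_notin[of s i] by (auto intro!: true_trees_cong false_trees_cong)

lemma true_trees_Node:
  "x \<in> true_trees (Node b) s \<longleftrightarrow> x s = 0 \<and> (\<forall>j. x \<in> false_trees (b j) (s @ [j]))"
  by (auto simp: true_trees_def false_trees_def locally_valid_def is_true_def)

lemma false_trees_Node:
  assumes "x s = i + 3"
  shows "x \<in> false_trees (Node b) s \<longleftrightarrow>
    x \<in> true_trees (b i) (s @ [i]) \<and> (\<forall>j. j \<noteq> i \<longrightarrow> x \<in> false_trees (b j) (s @ [j]))"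
proof -
  have "\<not> is_true (x s)" "locally_valid s x \<longleftrightarrow> is_true (x (s @ [i])) \<and> (\<forall>j. j \<noteq> i \<longrightarrow> \<not> is_true (x (s @ [j])))"
    using assms by (auto simp: is_true_def locally_valid_def)
  then show ?thesis
    using assms unfolding true_trees_def false_trees_def by (simp; metis)
qed

text \<open>A true tree is planted at child \<open>i\<close> and the root relabelled
  \<open>i + 3\<close>. Changes are confined to that child and to \<open>s\<close>, where the
  blurred label remains 0; \<open>K\<close> does not notice them.\<close>

lemma true_trees_flip:
  assumes "x \<in> K" "independent_of (subtree s) K" "x \<in> true_trees (Node b) s"
  shows "\<exists>y \<in> K \<inter> false_trees (Node b) s. y s = i + 3 \<and>
    (\<forall>t. t \<notin> subtree (s @ [i]) \<longrightarrow> t \<noteq> s \<longrightarrow> y t = x t)"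
proof -
  have "independent_of (subtree (s @ [i])) UNIV" by (simp add: independent_of_def)
  then obtain z where z: "z \<in> true_trees (b i) (s @ [i])" "\<And>t. t \<notin> subtree (s @ [i]) \<Longrightarrow> z t = x t"
    using independent_of_true_trees[of x UNIV "s @ [i]" "b i"] by auto
  define y where "y = z(s := i + 3)"
  have y: "y t = x t" if "t \<notin> subtree (s @ [i])" "t \<noteq> s" for t
    using that z(2) by (simp add: y_def)
  have "x t = y t" if "t \<notin> subtree s" for t
    using y[of t] that subtree_trans[OF append_in_subtree[of s "[i]"]] by force
  then have "y \<in> K" using assms(1,2) unfolding independent_of_def by metis
  moreover have "y \<in> true_trees (b i) (s @ [i])"
    using z(1) by (simp add: y_def)
  moreover have "y \<in> false_trees (b j) (s @ [j])" if "j \<noteq> i" for j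
  proof -
    have "y t = x t" if "t \<in> subtree (s @ [j])" for t
      using that \<open>j \<noteq> i\<close> y[of t] parent_notin[of s j] child_disjoint[of t s i j] by blast
    then have "y \<in> false_trees (b j) (s @ [j]) \<longleftrightarrow> x \<in> false_trees (b j) (s @ [j])"
      by (rule false_trees_cong)
    then show ?thesis using assms(3) by (simp add: true_trees_Node)
  qed
  moreover have "y s = i + 3" by (simp add: y_def)
  ultimately show ?thesis using y false_trees_Node[of y s i b] by blast
qed

lemma finite_avoids_children:
  assumes "finite F"
  shows "\<exists>m. \<forall>i\<ge>m. F \<inter> subtree (s @ [i]) = {}"
proof -
  have "finite ((\<lambda>t. t ! length s) ` F)" using assms by simp
  then obtain m where m: "\<forall>k\<in>(\<lambda>t. t ! length s) ` F. k < m"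
    by (auto simp: finite_nat_set_iff_bounded)
  have False if "m \<le> i" "t \<in> F" "t \<in> subtree (s @ [i])" for i t
    using that m by (auto simp: in_subtree nth_append)
  then show ?thesis by blast
qed

text \<open>
  Making a child far beyond a given finite condition true turns a true tree into a false one; by
  induction the sets of lower rank, which see the labels below \<open>s\<close> only blurred, do not notice.
\<close>

theorem borel_rank_transfer:
  assumes "borel_rank H b Y" "cyl_closed K" "independent_of (subtree s) K" "subtree s \<subseteq> H"
    and "meager_in (K \<inter> false_trees b s) Y"
  shows "meager_in (K \<inter> true_trees b s) Y"
  using assms
proof (induction arbitrary: K s rule: borel_rank.induct)
  case (view_open Y b)
  let ?Q = "K \<inter> false_trees (Node b) s"
  \<comment> \<open>An open set contains no true tree at all: flipping \<open>x\<close> through a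
    child outside the finite condition \<open>F\<close> would give a nonempty basic open part of the
    false trees inside \<open>Y\<close>.\<close>
  have False if x: "x \<in> Y" "x \<in> K \<inter> true_trees (Node b) s" for x
  proof -
    obtain F where F: "finite F" "\<And>y. \<forall>t\<in>F. view H t (y t) = view H t (x t) \<Longrightarrow> y \<in> Y"
      using view_open.hyps x(1) unfolding view_open_def by blast
    obtain i where i: "F \<inter> subtree (s @ [i]) = {}"
      using finite_avoids_children[OF F(1)] by blast
    obtain y where y: "y \<in> ?Q" "y s = i + 3" "\<And>t. t \<notin> subtree (s @ [i]) \<Longrightarrow> t \<noteq> s \<Longrightarrow> y t = x t"
      using true_trees_flip[of x K s b i] x(2) view_open.prems(2) by auto
    have "x s = 0" using x(2) by (simp add: true_trees_Node)
    have "s \<in> H" using view_open.prems(3) by auto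
    have "w \<in> Y" if w: "w \<in> cyl F y" for w
    proof (rule F(2), rule ballI)
      fix t assume t: "t \<in> F"
      then have "w t = y t" using w by (simp add: cyl_def)
      then show "view H t (w t) = view H t (x t)"
        using y(2) y(3)[of t] disjoint_iff[THEN iffD1, OF i] t \<open>x s = 0\<close> \<open>s \<in> H\<close>
        by (cases "t = s") (simp_all add: view_def)
    qed
    then have "meager_in (?Q \<inter> cyl F y) (?Q \<inter> cyl F y)"
      by (intro meager_in_mono[OF meager_in_cyl[OF view_open.prems(4) F(1)]]) auto
    moreover have "cyl_closed (?Q \<inter> cyl F y)"
      by (intro cyl_closed_Int view_open.prems(1) cyl_closed_false_trees cyl_closed_cyl F(1))
    moreover have "?Q \<inter> cyl F y \<noteq> {}" using y(1) by auto
    ultimately show False using cyl_closed_not_meager by blast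
  qed
  then have "Y \<inter> (K \<inter> true_trees (Node b) s) \<subseteq> {}" by blast
  then show ?case by (rule meager_in_mono[OF meager_in_empty])
next
  case (UN_Compl b Y)
  let ?P = "K \<inter> true_trees (Node b) s" and ?Q = "K \<inter> false_trees (Node b) s"
  have "meager_in ?P (Y k)" for k
  proof (rule ccontr)
    assume not_meager: "\<not> meager_in ?P (Y k)"
    obtain i0 where rank: "borel_rank H (b i0) (- Y k)" using UN_Compl.IH by blast
    \<comment> \<open>The complement of \<open>Y k\<close> has lower rank, hence the Baire property;
      as \<open>Y k\<close> is not meager, its complement is meager on some basic open part of the
      true trees.\<close>
    then obtain x F where x: "x \<in> ?P" and F: "finite F" and meager: "meager_in (?P \<inter> cyl F x) (- Y k)"
      using baire_property_dichotomy[OF borel_rank_baire_property[OF rank, of ?P]] not_meager by auto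
    obtain m where m: "\<And>i. m \<le> i \<Longrightarrow> F \<inter> subtree (s @ [i]) = {}"
      using finite_avoids_children[OF F] by blast
    \<comment> \<open>Recurrence of ranks yields a child that both avoids \<open>F\<close> and
      bounds the complement of \<open>Y k\<close>.\<close>
    obtain i where "m \<le> i" and IH: "\<And>K s. cyl_closed K \<Longrightarrow> independent_of (subtree s) K \<Longrightarrow> subtree s \<subseteq> H \<Longrightarrow>
        meager_in (K \<inter> false_trees (b i) s) (- Y k) \<Longrightarrow> meager_in (K \<inter> true_trees (b i) s) (- Y k)"
      using UN_Compl.IH[of m k] by blast
    then have i: "F \<inter> subtree (s @ [i]) = {}" using m by blast
    obtain y where y: "y \<in> ?Q" "y s = i + 3" "\<And>t. t \<notin> subtree (s @ [i]) \<Longrightarrow> t \<noteq> s \<Longrightarrow> y t = x t"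
      using true_trees_flip[of x K s b i] x UN_Compl.prems(2) by auto
    have xs: "x s = 0" using x by (simp add: true_trees_Node)
    have "s \<in> H" using UN_Compl.prems(3) by auto
    \<comment> \<open>\<open>L\<close> collects all conditions for a true tree in
      \<open>cyl F x\<close> except those at child \<open>i\<close>. Intersected with falsity of
      that child it is \<open>?P \<inter> cyl F x\<close>, so the induction hypothesis applies at
      \<open>s @ [i]\<close> with \<open>L\<close> in place of \<open>K\<close>.\<close>
    define R where "R j = (if j = i then UNIV else false_trees (b j) (s @ [j]))" for j
    define L where "L = K \<inter> cyl F x \<inter> cyl {s} (\<lambda>_. 0) \<inter> (\<Inter>j. R j)"
    have in_R: "z \<in> (\<Inter>j. R j) \<longleftrightarrow> (\<forall>j. j \<noteq> i \<longrightarrow> z \<in> false_trees (b j) (s @ [j]))" for z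
      by (auto simp: R_def)
    have "cyl_closed (R j)" for j
      using cyl_closed_false_trees[of "b j" "s @ [j]"] by (simp add: R_def cyl_closed_def)
    then have L_closed: "cyl_closed L"
      unfolding L_def by (intro cyl_closed_Int UN_Compl.prems(1) cyl_closed_cyl F cyl_closed_INT) auto
    have L_indep: "independent_of (subtree (s @ [i])) L"
      unfolding independent_of_def
    proof (intro allI impI)
      fix z w :: "nat list \<Rightarrow> nat" assume eq: "\<forall>t. t \<notin> subtree (s @ [i]) \<longrightarrow> z t = w t" and z: "z \<in> L"
      have "z t = w t" if "t \<notin> subtree s" for t
        using eq that subtree_trans[of "s @ [i]" s] append_in_subtree by blast
      then have "w \<in> K" using z UN_Compl.prems(2) unfolding independent_of_def L_def by blast
      moreover have "w \<in> cyl F x" using z eq i unfolding L_def cyl_def by fastforce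
      moreover have "w s = 0" using z eq parent_notin[of s i] by (simp add: L_def cyl_def)
      moreover have "w \<in> false_trees (b j) (s @ [j])" if "j \<noteq> i" for j
      proof -
        have "z t = w t" if "t \<in> subtree (s @ [j])" for t
          using eq that \<open>j \<noteq> i\<close> child_disjoint[of t s i j] by blast
        then have "z \<in> false_trees (b j) (s @ [j]) \<longleftrightarrow> w \<in> false_trees (b j) (s @ [j])"
          by (rule false_trees_cong)
        then show ?thesis using z that unfolding L_def Int_iff in_R by blast
      qed
      ultimately show "w \<in> L" unfolding L_def Int_iff in_R by (simp add: cyl_def)
    qed
    have "L \<inter> false_trees (b i) (s @ [i]) = ?P \<inter> cyl F x"
      unfolding set_eq_iff L_def Int_iff in_R true_trees_Node by (auto simp: cyl_def)
    then have L_meager: "meager_in (L \<inter> true_trees (b i) (s @ [i])) (- Y k)"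
      using IH[OF L_closed L_indep] meager UN_Compl.prems(3) subtree_trans[of "s @ [i]" s] by auto
    \<comment> \<open>Once child \<open>i\<close> is true, label 0 at \<open>s\<close> is wrong.
      Relabelling it \<open>i + 3\<close> gives genuine false trees, and sets of this rank do not
      see the change because \<open>s\<close> is hidden.\<close>
    define D where "D = {z. z s = i + 3 \<and> z(s := 0) \<in> L \<inter> true_trees (b i) (s @ [i])}"
    have "meager_in D {z. z(s := 0) \<in> - Y k}"
      unfolding D_def by (rule meager_in_update[OF L_meager]) (auto simp: L_def cyl_def)
    moreover have "z \<in> - Y k \<longleftrightarrow> z(s := 0) \<in> - Y k" if "z \<in> D" for z
      by (rule borel_rank_view[OF rank]) (use that \<open>s \<in> H\<close> in \<open>auto simp: view_def D_def\<close>)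
    then have "- Y k \<inter> D \<subseteq> {z. z(s := 0) \<in> - Y k}" by blast
    ultimately have "meager_in D (- Y k)" by (rule meager_in_mono)
    \<comment> \<open>So \<open>D\<close> is a nonempty basic open part of the false trees, on which
      both \<open>Y k\<close> and its complement would be meager.\<close>
    moreover have D: "D = ?Q \<inter> cyl (insert s F) y"
    proof (intro set_eqI)
      fix z
      show "z \<in> D \<longleftrightarrow> z \<in> ?Q \<inter> cyl (insert s F) y"
      proof (cases "z s = i + 3")
        case True
        have "z(s := 0) \<in> K \<longleftrightarrow> z \<in> K"
          using UN_Compl.prems(2) self_in_subtree[of s] unfolding independent_of_def
          by (metis fun_upd_apply)
        moreover have "z(s := 0) \<in> cyl F x \<longleftrightarrow> z \<in> cyl (insert s F) y"
        proof -
          have "(z(s := 0)) t = x t \<longleftrightarrow> z t = y t" if "t \<in> F" for t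
            using y(2) y(3)[of t] disjoint_iff[THEN iffD1, OF i] that True xs by (cases "t = s") simp_all
          then show ?thesis using True y(2) by (simp add: cyl_def del: fun_upd_apply)
        qed
        ultimately show ?thesis
          using True false_trees_Node[of z s i b] unfolding D_def L_def mem_Collect_eq Int_iff in_R
          by (auto simp: cyl_def)
      next
        case False
        then show ?thesis using y(2) by (auto simp: D_def cyl_def)
      qed
    qed
    moreover have "meager_in ?Q (Y k)" using UN_Compl.prems(4) by (rule meager_in_mono) blast
    then have "meager_in D (Y k)" unfolding D using F by (intro meager_in_cyl) auto
    ultimately have "meager_in D (- Y k \<union> Y k)" by (intro meager_in_Un)
    then have "meager_in D D" by (rule meager_in_mono) simp
    moreover have "cyl_closed D"
      unfolding D using F
      by (intro cyl_closed_Int UN_Compl.prems(1) cyl_closed_false_trees cyl_closed_cyl) auto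
    moreover have "y \<in> D" unfolding D using y(1) by simp
    ultimately show False using cyl_closed_not_meager by blast
  qed
  then show ?case by (rule meager_in_UN)
qed

section \<open>The equivalence relation\<close>

text \<open>
  The value at the root \<open>[]\<close> says which of the four vertices of a path a point is; the two trees
  hang at \<open>[1]\<close> and \<open>[2]\<close>.
\<close>

definition visible :: "nat \<Rightarrow> nat list set" where
  "visible k = (if k = 1 \<or> k = 2 then subtree [k] else {})"

definition points :: "(nat list \<Rightarrow> nat) set" where
  "points = {x. x [] < 4 \<and> (\<forall>t. t \<noteq> [] \<longrightarrow> t \<notin> visible (x []) \<longrightarrow> blur (x t) = x t) \<and>
     (\<forall>k. k = 1 \<or> k = 2 \<longrightarrow> x [] = k \<longrightarrow> valid_below [k] x \<and> is_true (x [k]))}"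

definition same_base :: "(nat list \<Rightarrow> nat) \<Rightarrow> (nat list \<Rightarrow> nat) \<Rightarrow> bool" where
  "same_base x y \<longleftrightarrow> (\<forall>t. t \<noteq> [] \<longrightarrow> blur (x t) = blur (y t))"

definition point :: "nat \<Rightarrow> (nat list \<Rightarrow> nat) \<Rightarrow> nat list \<Rightarrow> nat" where
  "point k x t = (if t = [] then k else if t \<in> visible k then x t else blur (x t))"

text \<open>Coding positions by numbers places the space inside the Baire space
  \<open>nat \<Rightarrow> nat\<close>.\<close>

definition decode :: "(nat \<Rightarrow> nat) \<Rightarrow> nat list \<Rightarrow> nat" where
  "decode f = f \<circ> list_encode"

definition encode :: "(nat list \<Rightarrow> nat) \<Rightarrow> nat \<Rightarrow> nat" where
  "encode x = x \<circ> list_decode"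

definition carrier :: "(nat \<Rightarrow> nat) set" where
  "carrier = decode -` points"

definition edges :: "((nat \<Rightarrow> nat) \<times> (nat \<Rightarrow> nat)) set" where
  "edges = {(f, g). f \<in> carrier \<and> g \<in> carrier \<and> same_base (decode f) (decode g) \<and>
     (decode f [] = Suc (decode g []) \<or> decode g [] = Suc (decode f []))}"

lemma decode_encode [simp]: "decode (encode x) = x"
  by (simp add: decode_def encode_def fun_eq_iff)

lemma encode_decode [simp]: "encode (decode f) = f"
  by (simp add: decode_def encode_def fun_eq_iff)

lemma encode_in_carrier [simp]: "encode x \<in> carrier \<longleftrightarrow> x \<in> points"
  by (simp add: carrier_def)

lemma point_root [simp]: "point k x [] = k"
  by (simp add: point_def)

lemma same_base_point: "same_base x (point k x)"
  by (simp add: same_base_def point_def)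

lemma same_base_sym: "same_base x y \<Longrightarrow> same_base y x"
  by (simp add: same_base_def)

lemma same_base_trans: "same_base x y \<Longrightarrow> same_base y z \<Longrightarrow> same_base x z"
  by (simp add: same_base_def)

lemma valid_below_cong:
  assumes "\<And>t. t \<in> subtree s \<Longrightarrow> x t = y t"
  shows "valid_below s x \<longleftrightarrow> valid_below s y"
proof -
  have "x (s @ t) = y (s @ t)" for t using assms by simp
  then show ?thesis by (simp add: valid_below_def locally_valid_def)
qed

lemma point_in_points:
  assumes "k < 4" "k = 1 \<or> k = 2 \<Longrightarrow> valid_below [k] x \<and> is_true (x [k])"
  shows "point k x \<in> points"
proof -
  have "valid_below [k] (point k x) \<longleftrightarrow> valid_below [k] x" if "k = 1 \<or> k = 2"
    by (rule valid_below_cong) (use that in \<open>auto simp: point_def visible_def in_subtree\<close>)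
  moreover have "point k x [k] = x [k]" if "k = 1 \<or> k = 2"
    using that by (auto simp: point_def visible_def)
  ultimately show ?thesis
    unfolding points_def mem_Collect_eq point_root using assms by (auto simp: point_def)
qed

text \<open>Evidence on well-founded trees is unique, so the only points over the base of
  \<open>x\<close> are the at most four \<open>point k x\<close>, with vertices 1 and 2 present only
  if their tree is true.\<close>

lemma points_unique:
  assumes x: "has_shape b [1] x" "has_shape b [2] x" and p: "p \<in> points" and base: "same_base x p"
  shows "p = point (p []) x" "p [] = 1 \<or> p [] = 2 \<Longrightarrow> is_true (x [p []])"
proof -
  have tree: "p t = x t" if "t \<in> visible (p [])" for t
  proof -
    have k: "p [] = 1 \<or> p [] = 2" and t: "t \<in> subtree [p []]"
      using that by (auto simp: visible_def split: if_splits)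
    show ?thesis
    proof (rule has_shape_unique[OF _ _ _ t])
      show "has_shape b [p []] x" using k x by metis
      show "valid_below [p []] p" using k p by (auto simp: points_def)
      show "blur (x u) = blur (p u)" if "u \<in> subtree [p []]" for u
        using that base by (auto simp: same_base_def in_subtree)
    qed
  qed
  show "p = point (p []) x"
  proof
    fix t
    show "p t = point (p []) x t"
    proof (cases "t = [] \<or> t \<in> visible (p [])")
      case True
      then show ?thesis using tree by (auto simp: point_def)
    next
      case False
      then have "p t = blur (p t)" using p by (simp add: points_def)
      then show ?thesis using False base by (simp add: point_def same_base_def)
    qed
  qed
  show "is_true (x [p []])" if "p [] = 1 \<or> p [] = 2"
  proof -
    have "is_true (p [p []])" using p that by (auto simp: points_def)
    moreover have "p [p []] = x [p []]" by (rule tree) (use that in \<open>auto simp: visible_def\<close>)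
    ultimately show ?thesis by simp
  qed
qed

text \<open>Vertex numbers change by one along an edge, so a path from vertices 0, 1 to vertices 2,
  3 must at some time step from 1 to 2; both of these then exist over the common base.\<close>

lemma edges_connected:
  assumes "(f, g) \<in> edges\<^sup>*"
  shows "same_base (decode f) (decode g) \<and> (decode f [] \<le> 1 \<longrightarrow> 2 \<le> decode g [] \<longrightarrow>
    (\<forall>k. k = 1 \<or> k = 2 \<longrightarrow> (\<exists>p\<in>points. p [] = k \<and> same_base (decode f) p)))"
  using assms
proof induction
  case base
  then show ?case by (simp add: same_base_def)
next
  case (step g h)
  then have base: "same_base (decode f) (decode g)" "same_base (decode f) (decode h)"
    by (auto simp: edges_def intro: same_base_trans)
  have "\<forall>k. k = 1 \<or> k = 2 \<longrightarrow> (\<exists>p\<in>points. p [] = k \<and> same_base (decode f) p)"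
    if "decode f [] \<le> 1" "2 \<le> decode h []"
  proof (cases "2 \<le> decode g []")
    case True
    then show ?thesis using step.IH that(1) by blast
  next
    case False
    then have "decode g [] = 1" "decode h [] = 2" "decode g \<in> points" "decode h \<in> points"
      using step.hyps(2) that(2) by (auto simp: edges_def carrier_def)
    then show ?thesis using base by blast
  qed
  then show ?case using base(2) by blast
qed

section \<open>Topology of the space and of the edge set\<close>

lemma cyl_closed_imp:
  assumes "cyl_closed {x. A x}"
  shows "cyl_closed {x. x i = k \<longrightarrow> A x}"
  unfolding cyl_closed_def
proof (intro allI impI CollectI)
  fix x assume *: "\<forall>F. finite F \<longrightarrow> cyl F x \<inter> {x. x i = k \<longrightarrow> A x} \<noteq> {}" and "x i = k"
  have "cyl F x \<inter> {x. A x} \<noteq> {}" if "finite F" for F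
  proof -
    have "cyl (insert i F) x \<inter> {x. x i = k \<longrightarrow> A x} \<noteq> {}" using * that by simp
    then obtain y where "y \<in> cyl (insert i F) x" "y i = k \<longrightarrow> A y" by blast
    then show ?thesis using \<open>x i = k\<close> by (auto simp: cyl_def)
  qed
  then show "A x" using assms by (simp add: cyl_closed_def)
qed

lemma cyl_closed_points: "cyl_closed points"
proof -
  have "cyl_closed {x :: nat list \<Rightarrow> nat. x [] < 4}"
    by (rule cyl_closed_coordinate[of "\<lambda>k. k < 4"])
  moreover have "cyl_closed {x. \<forall>t. t \<noteq> [] \<longrightarrow> t \<notin> visible (x []) \<longrightarrow> blur (x t) = x t}"
    by (rule cyl_closed_all, rule cyl_closed_coordinate2[of
      "\<lambda>k l. t \<noteq> [] \<longrightarrow> t \<notin> visible k \<longrightarrow> blur l = l" "[]" t for t])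
  moreover have "cyl_closed {x. \<forall>k. k = 1 \<or> k = 2 \<longrightarrow> x [] = k \<longrightarrow> valid_below [k] x \<and> is_true (x [k])}"
  proof (rule cyl_closed_all)
    fix k :: nat
    have "cyl_closed {x. valid_below [k] x}"
      unfolding valid_below_def by (intro cyl_closed_all cyl_closed_locally_valid)
    then have "cyl_closed {x. valid_below [k] x \<and> is_true (x [k])}"
      by (rule cyl_closed_conj) (rule cyl_closed_coordinate)
    then have "cyl_closed {x. x [] = k \<longrightarrow> valid_below [k] x \<and> is_true (x [k])}"
      by (rule cyl_closed_imp)
    then show "cyl_closed {x. k = 1 \<or> k = 2 \<longrightarrow> x [] = k \<longrightarrow> valid_below [k] x \<and> is_true (x [k])}"
      by (cases "k = 1 \<or> k = 2") (simp_all add: cyl_closed_UNIV)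
  qed
  ultimately show ?thesis unfolding points_def by (intro cyl_closed_conj)
qed

lemma open_coordinate: "open {f :: nat \<Rightarrow> nat. Q (f n)}"
proof -
  have "open ((\<lambda>f :: nat \<Rightarrow> nat. f n) -` {k. Q k})"
    by (intro open_vimage continuous_on_product_coordinates) (simp add: open_discrete)
  then show ?thesis by (simp add: vimage_def)
qed

lemma open_coordinate_pair: "open {p :: (nat \<Rightarrow> nat) \<times> (nat \<Rightarrow> nat). Q (fst p m) (snd p n)}"
proof -
  have "{p :: (nat \<Rightarrow> nat) \<times> (nat \<Rightarrow> nat). Q (fst p m) (snd p n)} =
      (\<Union>k. {f. f m = k} \<times> {g. Q k (g n)})"
    by auto
  also have "open \<dots>"
    by (intro open_UN ballI open_Times open_coordinate)
  finally show ?thesis .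
qed

lemma closed_coordinate_pair: "closed {p :: (nat \<Rightarrow> nat) \<times> (nat \<Rightarrow> nat). Q (fst p m) (snd p n)}"
  using open_coordinate_pair[of "\<lambda>k l. \<not> Q k l" m n] by (simp add: closed_def Compl_eq)

lemma closed_decode:
  assumes "cyl_closed C"
  shows "closed (decode -` C)"
  unfolding closed_def
proof (subst open_subopen, rule ballI)
  fix f assume "f \<in> - decode -` C"
  then obtain F where F: "finite F" "cyl F (decode f) \<inter> C = {}"
    using assms unfolding cyl_closed_def by blast
  let ?U = "\<Inter>t\<in>F. {g. g (list_encode t) = f (list_encode t)}"
  have "open ?U" using F(1) by (intro open_INT ballI open_coordinate)
  moreover have "f \<in> ?U" by simp
  moreover have "decode g \<in> cyl F (decode f)" if "g \<in> ?U" for g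
    using that by (simp add: cyl_def decode_def)
  then have "?U \<subseteq> - decode -` C" using F(2) by blast
  ultimately show "\<exists>T. open T \<and> f \<in> T \<and> T \<subseteq> - decode -` C" by blast
qed

lemma closed_carrier: "closed carrier"
  unfolding carrier_def by (rule closed_decode[OF cyl_closed_points])

lemma closed_edges: "closed edges"
proof -
  have "edges = carrier \<times> carrier \<inter>
     (\<Inter>t\<in>{t. t \<noteq> []}. {p. blur (fst p (list_encode t)) = blur (snd p (list_encode t))}) \<inter>
     {p. fst p (list_encode []) = Suc (snd p (list_encode [])) \<or> snd p (list_encode []) = Suc (fst p (list_encode []))}"
    by (auto simp: edges_def same_base_def decode_def)
  also have "closed \<dots>"
    by (intro closed_Int closed_Times closed_carrier closed_INT ballI
        closed_coordinate_pair[of "\<lambda>k l. blur k = blur l"] closed_coordinate_pair[of "\<lambda>k l. k = Suc l \<or> l = Suc k"])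
  finally show ?thesis .
qed

lemma polish_carrier: "polish_topology (top_of_set carrier)"
  unfolding polish_topology_def
proof
  have "(euclidean :: nat topology) = discrete_topology UNIV"
    by (simp add: topology_eq open_discrete)
  then have "completely_metrizable_space (product_topology (\<lambda>_ :: nat. euclidean :: nat topology) UNIV)"
    by (simp add: completely_metrizable_space_product_topology completely_metrizable_space_discrete_topology)
  then have "completely_metrizable_space (euclidean :: (nat \<Rightarrow> nat) topology)"
    by (simp add: euclidean_product_topology)
  then show "completely_metrizable_space (top_of_set carrier)"
    by (rule completely_metrizable_space_closedin) (simp add: closed_carrier flip: closed_closedin)
  obtain B :: "(nat \<Rightarrow> nat) set set" where B: "countable B" "topological_basis B"
    using ex_countable_basis by blast
  then have "\<forall>U x. open U \<and> x \<in> U \<longrightarrow> (\<exists>V\<in>B. x \<in> V \<and> V \<subseteq> U)"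
    by (metis topological_basisE)
  moreover have "\<forall>V\<in>B. open V" using B(2) topological_basis_open by blast
  ultimately have "second_countable (euclidean :: (nat \<Rightarrow> nat) topology)"
    unfolding second_countable_def open_openin[symmetric] using B(1) by blast
  then have "second_countable (top_of_set carrier)"
    by (rule second_countable_subtopology)
  then show "separable_space (top_of_set carrier)"
    by (rule second_countable_imp_separable_space)
qed

section \<open>Pulling Borel sets of pairs back to ranked sets of trees\<close>

lemma open_imp_cyl_open:
  fixes U :: "(nat \<Rightarrow> nat) set"
  assumes "open U"
  shows "cyl_open U"
  unfolding cyl_open_def
proof
  fix f assume "f \<in> U"
  then obtain V where V: "f \<in> Pi\<^sub>E UNIV V" "finite {i. V i \<noteq> UNIV}" "Pi\<^sub>E UNIV V \<subseteq> U"
    using product_topology_open_contains_basis[of "\<lambda>_. euclidean" UNIV U f] assms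
    by (auto simp: open_fun_def)
  have "cyl {i. V i \<noteq> UNIV} f \<subseteq> Pi\<^sub>E UNIV V"
    using V(1) by (fastforce simp: cyl_def PiE_iff)
  then show "\<exists>F. finite F \<and> cyl F f \<subseteq> U" using V(2,3) by blast
qed

text \<open>Outside their visible parts the two points depend on \<open>x\<close> only through
  blurred labels. Hence hiding \<open>H\<close> keeps the map from \<open>x\<close> to the pair
  continuous as long as \<open>H\<close> misses both visible parts.\<close>

lemma view_open_vimage:
  assumes U: "open U" and H: "visible k \<inter> H = {}" "visible l \<inter> H = {}"
  shows "view_open H {x. (encode (point k x), encode (point l x)) \<in> U}"
  unfolding view_open_def
proof
  fix x assume "x \<in> {x. (encode (point k x), encode (point l x)) \<in> U}"
  then obtain A B where AB: "open A" "open B" "encode (point k x) \<in> A" "encode (point l x) \<in> B" "A \<times> B \<subseteq> U"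
    using U by (auto elim: open_prod_elim)
  obtain M where M: "finite M" "cyl M (encode (point k x)) \<subseteq> A"
    using open_imp_cyl_open[OF AB(1)] AB(3) unfolding cyl_open_def by blast
  obtain N where N: "finite N" "cyl N (encode (point l x)) \<subseteq> B"
    using open_imp_cyl_open[OF AB(2)] AB(4) unfolding cyl_open_def by blast
  have point: "point j y t = point j x t"
    if "view H t (y t) = view H t (x t)" "visible j \<inter> H = {}" for j y t
  proof (cases "t \<in> visible j")
    case True
    then have "t \<notin> H" using that(2) by blast
    then show ?thesis using that(1) by (simp add: point_def view_def)
  next
    case False
    have "blur (y t) = blur (x t)" using arg_cong[OF that(1), of blur] by (simp add: view_def split: if_splits)
    then show ?thesis using False by (simp add: point_def)
  qed
  have "y \<in> {x. (encode (point k x), encode (point l x)) \<in> U}"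
    if y: "\<forall>t\<in>list_decode ` (M \<union> N). view H t (y t) = view H t (x t)" for y
  proof -
    have "encode (point j y) n = encode (point j x) n" if "n \<in> M \<union> N" "visible j \<inter> H = {}" for j n
      unfolding encode_def o_def by (rule point) (use y that in auto)
    then have "encode (point k y) \<in> cyl M (encode (point k x))" "encode (point l y) \<in> cyl N (encode (point l x))"
      using H by (simp_all add: cyl_def)
    then have "(encode (point k y), encode (point l y)) \<in> A \<times> B" using M(2) N(2) by blast
    then show ?thesis using AB(5) by blast
  qed
  then show "\<exists>F. finite F \<and> (\<forall>y. (\<forall>t\<in>F. view H t (y t) = view H t (x t)) \<longrightarrow>
      y \<in> {x. (encode (point k x), encode (point l x)) \<in> U})"
    using M(1) N(1) by (intro exI[of _ "list_decode ` (M \<union> N)"]) blast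
qed

text \<open>Induction along the generation of the sigma-algebra. Agreement is claimed only where
  both points lie in the space, since complements in \<open>carrier \<times> carrier\<close> become
  full complements of sets of trees.\<close>

lemma borel_rank_vimage:
  assumes A: "borel_in (prod_topology (top_of_set carrier) (top_of_set carrier)) A"
    and H: "visible k \<inter> H = {}" "visible l \<inter> H = {}"
  shows "\<exists>b Y. borel_rank H b Y \<and> (\<forall>x. point k x \<in> points \<longrightarrow> point l x \<in> points \<longrightarrow>
    (x \<in> Y \<longleftrightarrow> (encode (point k x), encode (point l x)) \<in> A))"
proof -
  define good where "good A Y \<longleftrightarrow> (\<forall>x. point k x \<in> points \<longrightarrow> point l x \<in> points \<longrightarrow>
    (x \<in> Y \<longleftrightarrow> (encode (point k x), encode (point l x)) \<in> A))" for A Y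
  have "A \<in> sigma_sets (carrier \<times> carrier) {U. openin (top_of_set (carrier \<times> carrier)) U}"
    using A by (simp add: borel_in_def)
  then have "\<exists>b Y. borel_rank H b Y \<and> good A Y"
  proof induction
    case (Basic A)
    then obtain U where U: "open U" "A = carrier \<times> carrier \<inter> U" by (auto simp: openin_open)
    have "borel_rank H (Node (\<lambda>_. Leaf)) {x. (encode (point k x), encode (point l x)) \<in> U}"
      by (rule borel_rank.view_open[OF view_open_vimage[OF U(1) H]])
    then show ?case unfolding good_def U(2) by (intro exI conjI) auto
  next
    case Empty
    have "borel_rank H (Node (\<lambda>_. Leaf)) {}"
      by (rule borel_rank.view_open) (simp add: view_open_def)
    then show ?case unfolding good_def by (intro exI conjI) auto
  next
    case (Compl A)
    then obtain b Y where "borel_rank H b Y" "good A Y" by blast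
    then have "borel_rank H (Node (\<lambda>_. b)) (- Y)" "good (carrier \<times> carrier - A) (- Y)"
      by (auto simp: good_def intro: borel_rank_Compl)
    then show ?case by blast
  next
    case (Union A)
    then obtain b Y where Y: "\<And>n. borel_rank H (b n) (Y n)" "\<And>n. good (A n) (Y n)" by metis
    have "good (\<Union>n. A n) (\<Union>n. Y n)" using Y(2) by (auto simp: good_def)
    then show ?case using borel_rank_UN[of H b Y] Y(1) by blast
  qed
  then show ?thesis by (simp add: good_def)
qed

definition connected_points :: "((nat \<Rightarrow> nat) \<times> (nat \<Rightarrow> nat)) set" where
  "connected_points = {(f, g). f \<in> carrier \<and> g \<in> carrier \<and> (f, g) \<in> edges\<^sup>*}"

lemma sym_edges: "sym edges"
  by (auto simp: sym_def edges_def intro: same_base_sym)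

lemma equiv_connected_points: "equiv carrier connected_points"
proof (rule equivI)
  show "connected_points \<subseteq> carrier \<times> carrier" "refl_on carrier connected_points"
    by (auto simp: connected_points_def refl_on_def)
  show "sym connected_points"
    using sym_rtrancl[OF sym_edges] by (auto simp: connected_points_def sym_def)
  show "trans connected_points"
    by (auto simp: connected_points_def trans_def)
qed

lemma borel_graphing_edges: "borel_graphing (top_of_set carrier) connected_points edges"
proof -
  have "openin (top_of_set (carrier \<times> carrier)) (carrier \<times> carrier - edges)"
    using closed_edges by (metis Diff_Int_distrib Int_Diff Int_UNIV_right Diff_eq closed_def openin_open)
  then have "carrier \<times> carrier - (carrier \<times> carrier - edges) \<in>
      sigma_sets (carrier \<times> carrier) {U. openin (top_of_set (carrier \<times> carrier)) U}"
    by (intro sigma_sets.Compl sigma_sets.Basic) simp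
  moreover have "carrier \<times> carrier - (carrier \<times> carrier - edges) = edges"
    by (auto simp: edges_def)
  ultimately have "borel_in (prod_topology (top_of_set carrier) (top_of_set carrier)) edges"
    by (simp add: borel_in_def)
  moreover have "irrefl edges" by (auto simp: irrefl_def edges_def)
  ultimately show ?thesis
    using sym_edges
    by (auto simp: borel_graphing_def borel_graph_def connected_points_def path_of_length_def rtrancl_power)
qed

section \<open>Every Borel graphing has diameter at least three\<close>

lemma borel_graphing_edgeD:
  assumes "borel_graphing (top_of_set carrier) E G" "(f, g) \<in> G"
  shows "f \<in> carrier" "g \<in> carrier" "(f, g) \<in> E" "f \<noteq> g"
proof -
  have "G \<subseteq> carrier \<times> carrier"
    using assms(1) sigma_sets_into_sp[of "{U. openin (top_of_set (carrier \<times> carrier)) U}" "carrier \<times> carrier" G]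
    by (auto simp: borel_graphing_def borel_graph_def borel_in_def dest: openin_imp_subset)
  then show fg: "f \<in> carrier" "g \<in> carrier" using assms(2) by auto
  have "path_of_length G 1 f g" using assms(2) by (simp add: path_of_length_def)
  then show "(f, g) \<in> E" using assms(1) fg by (auto simp: borel_graphing_def)
  show "f \<noteq> g" using assms by (auto simp: borel_graphing_def borel_graph_def irrefl_def)
qed

lemma graph_diameter_ge_3:
  assumes "borel_graphing X E G" "(f, g) \<in> E" "f \<noteq> g" "(f, g) \<notin> G"
    and "\<And>h. (f, h) \<in> G \<Longrightarrow> (h, g) \<in> G \<Longrightarrow> False"
  shows "3 \<le> graph_diameter E G"
proof -
  have "3 \<le> enat n" if "path_of_length G n f g" for n
  proof (rule ccontr)
    assume "\<not> 3 \<le> enat n"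
    then have "n = 0 \<or> n = 1 \<or> n = 2" by (auto simp: numeral_eq_enat)
    then show False using that assms(3-5) by (auto simp: path_of_length_def numeral_2_eq_2)
  qed
  then have "3 \<le> graph_dist G f g"
    unfolding graph_dist_def by (intro INF_greatest) simp
  also have "\<dots> \<le> graph_diameter E G"
    unfolding graph_diameter_def using assms(2) by (intro SUP_upper2[of "(f, g)"]) auto
  finally show ?thesis .
qed

text \<open>The ends of the edge are equivalent, hence joined by a path in \<open>edges\<close> that
  crosses from vertex 1 to vertex 2. Both vertices exist, so both trees are true.\<close>

lemma crossing_edge:
  assumes G: "borel_graphing (top_of_set carrier) connected_points G"
    and x: "has_shape b [1] x" "has_shape b [2] x"
    and edge: "(encode (point k x), encode (point l x)) \<in> G" and "k \<le> 1" "2 \<le> l" and j: "j = 1 \<or> j = 2"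
  shows "is_true (x [j])"
proof -
  have "(encode (point k x), encode (point l x)) \<in> edges\<^sup>*"
    using borel_graphing_edgeD(3)[OF G edge] by (simp add: connected_points_def)
  then obtain p where p: "p \<in> points" "p [] = j" "same_base (point k x) p"
    using edges_connected[of "encode (point k x)" "encode (point l x)"] \<open>k \<le> 1\<close> \<open>2 \<le> l\<close> j by auto
  then have "same_base x p" using same_base_trans same_base_point by blast
  then show ?thesis using points_unique(2)[OF x p(1)] p(2) j by blast
qed

lemma graphing_diameter_ge_3:
  assumes G: "borel_graphing (top_of_set carrier) connected_points G"
  shows "3 \<le> graph_diameter connected_points G"
proof (rule ccontr)
  assume small: "\<not> ?thesis"
  let ?in_G = "\<lambda>k l x. (encode (point k x), encode (point l x)) \<in> G"
  have borel: "borel_in (prod_topology (top_of_set carrier) (top_of_set carrier)) G"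
    using G by (simp add: borel_graphing_def borel_graph_def)
  have vis: "visible 0 = {}" "visible 1 = subtree [1]" "visible 2 = subtree [2]" "visible 3 = {}"
    by (simp_all add: visible_def)
  have disjoint: "subtree [1] \<inter> subtree [2 :: nat] = {}" by (auto simp: in_subtree)
  \<comment> \<open>Vertices 0, 1 and 3 show no evidence for the second tree, so everything but the
    first tree may be hidden from \<open>Y\<^sub>0\<close> and \<open>Y\<^sub>1\<close>. For
    \<open>Y\<^sub>2\<close> the roles of the trees are exchanged.\<close>
  obtain b\<^sub>0 Y\<^sub>0 where Y\<^sub>0: "borel_rank (- subtree [1]) b\<^sub>0 Y\<^sub>0"
      "\<And>x. point 0 x \<in> points \<Longrightarrow> point 3 x \<in> points \<Longrightarrow> x \<in> Y\<^sub>0 \<longleftrightarrow> ?in_G 0 3 x"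
    using borel_rank_vimage[OF borel, of 0 "- subtree [1]" 3] vis by auto
  obtain b\<^sub>1 Y\<^sub>1 where Y\<^sub>1: "borel_rank (- subtree [1]) b\<^sub>1 Y\<^sub>1"
      "\<And>x. point 1 x \<in> points \<Longrightarrow> point 3 x \<in> points \<Longrightarrow> x \<in> Y\<^sub>1 \<longleftrightarrow> ?in_G 1 3 x"
    using borel_rank_vimage[OF borel, of 1 "- subtree [1]" 3] vis by auto
  obtain b\<^sub>2 Y\<^sub>2 where Y\<^sub>2: "borel_rank (- subtree [2]) b\<^sub>2 Y\<^sub>2"
      "\<And>x. point 0 x \<in> points \<Longrightarrow> point 2 x \<in> points \<Longrightarrow> x \<in> Y\<^sub>2 \<longleftrightarrow> ?in_G 0 2 x"
    using borel_rank_vimage[OF borel, of 0 "- subtree [2]" 2] vis by auto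
  have "\<exists>b. borel_rank (- subtree [1]) b (\<Union>n :: nat. if n = 0 then Y\<^sub>0 else Y\<^sub>1)"
    by (rule borel_rank_UN[where b = "\<lambda>n. if n = 0 then b\<^sub>0 else b\<^sub>1"]) (use Y\<^sub>0(1) Y\<^sub>1(1) in simp)
  moreover have "(\<Union>n :: nat. if n = 0 then Y\<^sub>0 else Y\<^sub>1) = Y\<^sub>0 \<union> Y\<^sub>1" by (auto split: if_splits)
  ultimately obtain b where b: "borel_rank (- subtree [1]) b (Y\<^sub>0 \<union> Y\<^sub>1)" "borel_rank (- subtree [2]) b Y\<^sub>2"
    using borel_rank_common Y\<^sub>2(1) by metis
  define T where "T k = true_trees b [k]" for k
  define F where "F k = false_trees b [k]" for k
  have blurred: "point 0 x \<in> points" "point 3 x \<in> points" for x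
    by (rule point_in_points; simp)+
  have labelled: "point k x \<in> points" if "x \<in> T k" "k = 1 \<or> k = 2" for k x
    using that by (intro point_in_points) (auto simp: T_def true_trees_def has_shape_valid)
  have shape: "has_shape b [k] x" if "x \<in> T k \<or> x \<in> F k" for k x
    using that by (auto simp: T_def F_def true_trees_def false_trees_def)
  have indep: "independent_of (subtree [k]) (T l)" if "k \<noteq> l" for k l
    unfolding independent_of_def T_def
  proof (intro allI impI)
    fix x y assume "\<forall>t. t \<notin> subtree [k] \<longrightarrow> x t = y t" "x \<in> true_trees b [l]"
    moreover from this(1) have "x t = y t" if "t \<in> subtree [l]" for t
      using that \<open>k \<noteq> l\<close> by (auto simp: in_subtree)
    ultimately show "y \<in> true_trees b [l]" using true_trees_cong[of "[l]" x y b] by blast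
  qed
  have closed: "cyl_closed (T k)" for k by (simp add: T_def cyl_closed_true_trees)
  have not_true: "\<not> is_true (x [k])" if "x \<in> F k" for k x
    using that by (simp add: F_def false_trees_def)
  \<comment> \<open>Vertices 0 and 3 have distance at most 2. By uniqueness a middle vertex is one
    of the four \<open>?p k\<close>, and each of them yields one of the three listed edges.\<close>
  have "T 1 \<inter> T 2 \<subseteq> (Y\<^sub>0 \<union> Y\<^sub>1) \<union> Y\<^sub>2"
  proof
    fix x assume x: "x \<in> T 1 \<inter> T 2"
    let ?p = "\<lambda>k. encode (point k x)"
    have points: "?p k \<in> carrier" if "k < 4" for k
    proof -
      have "k = 0 \<or> k = 1 \<or> k = 2 \<or> k = 3" using that by linarith
      then show ?thesis using x blurred labelled by auto
    qed
    have step: "(?p k, ?p (Suc k)) \<in> edges" if "Suc k < 4" for k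
      using that points[of k] points[of "Suc k"] same_base_point[of x]
      by (auto simp: edges_def intro: same_base_trans same_base_sym)
    have "(?p 0, ?p 1) \<in> edges" "(?p 1, ?p 2) \<in> edges" "(?p 2, ?p 3) \<in> edges"
      using step[of 0] step[of 1] step[of 2] by (simp_all add: numeral_2_eq_2 numeral_3_eq_3)
    then have "(?p 0, ?p 3) \<in> edges\<^sup>*" by (meson rtrancl.rtrancl_into_rtrancl rtrancl.rtrancl_refl)
    then have related: "(?p 0, ?p 3) \<in> connected_points" using points by (simp add: connected_points_def)
    have "decode (?p 0) [] \<noteq> decode (?p 3) []" by simp
    then have distinct: "?p 0 \<noteq> ?p 3" by metis
    have middle: "?in_G 0 3 x \<or> ?in_G 1 3 x \<or> ?in_G 0 2 x" if h: "(?p 0, h) \<in> G" "(h, ?p 3) \<in> G" for h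
    proof -
      have "(?p 0, h) \<in> edges\<^sup>*" "decode h \<in> points"
        using borel_graphing_edgeD[OF G h(1)] by (auto simp: connected_points_def carrier_def)
      then have "same_base x (decode h)"
        using edges_connected[of "?p 0" h] same_base_point[of x 0] same_base_trans by auto
      moreover have "has_shape b [1] x" "has_shape b [2] x" using x shape by auto
      ultimately have "decode h = point (decode h []) x"
        using \<open>decode h \<in> points\<close> points_unique(1) by blast
      then have "h = ?p (decode h [])" by (metis encode_decode)
      moreover have "decode h [] < 4" using \<open>decode h \<in> points\<close> by (simp add: points_def)
      then have "decode h [] = 0 \<or> decode h [] = 1 \<or> decode h [] = 2 \<or> decode h [] = 3" by linarith
      ultimately show ?thesis using h by metis
    qed
    have "?in_G 0 3 x \<or> ?in_G 1 3 x \<or> ?in_G 0 2 x"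
      using small graph_diameter_ge_3[OF G related distinct] middle by blast
    then show "x \<in> (Y\<^sub>0 \<union> Y\<^sub>1) \<union> Y\<^sub>2"
      using Y\<^sub>0(2)[of x] Y\<^sub>1(2)[of x] Y\<^sub>2(2)[of x] blurred labelled[of x] x by auto
  qed
  \<comment> \<open>If the second tree is false, no crossing edge exists, so
    \<open>Y\<^sub>0 \<union> Y\<^sub>1\<close> is even empty there. Transfer at \<open>[2]\<close>,
    with \<open>T 1\<close> as the side condition, carries meagerness to the true trees.\<close>
  moreover have "meager_in (T 1 \<inter> T 2) (Y\<^sub>0 \<union> Y\<^sub>1)"
  proof -
    have "x \<notin> Y\<^sub>0 \<union> Y\<^sub>1" if x: "x \<in> T 1 \<inter> F 2" for x
      using Y\<^sub>0(2)[of x] Y\<^sub>1(2)[of x] blurred labelled[of x 1] x shape[of x] not_true[of x 2]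
        crossing_edge[OF G, of b x 0 3 2] crossing_edge[OF G, of b x 1 3 2] by auto
    then have "meager_in (T 1 \<inter> F 2) (Y\<^sub>0 \<union> Y\<^sub>1)"
      by (intro meager_in_mono[OF meager_in_empty]) blast
    then show ?thesis
      using borel_rank_transfer[OF b(1) closed[of 1] indep[of 2 1]] disjoint unfolding T_def F_def by auto
  qed
  moreover have "meager_in (T 1 \<inter> T 2) Y\<^sub>2"
  proof -
    have "x \<notin> Y\<^sub>2" if x: "x \<in> T 2 \<inter> F 1" for x
      using Y\<^sub>2(2)[of x] blurred labelled[of x 2] x shape[of x] not_true[of x 1]
        crossing_edge[OF G, of b x 0 2 1] by auto
    then have "meager_in (T 2 \<inter> F 1) Y\<^sub>2"
      by (intro meager_in_mono[OF meager_in_empty]) blast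
    then show ?thesis
      using borel_rank_transfer[OF b(2) closed[of 2] indep[of 1 2]] disjoint unfolding T_def F_def
      by (auto simp: Int_commute)
  qed
  ultimately have "meager_in (T 1 \<inter> T 2) (T 1 \<inter> T 2)"
    using meager_in_Un meager_in_mono by (metis Int_lower1 order_trans)
  moreover obtain x where "x \<in> T 1" using exists_has_shape[of b "[1]"] by (auto simp: T_def true_trees_def)
  then have "T 1 \<inter> T 2 \<noteq> {}"
    using independent_of_true_trees[of x "T 1" "[2]" b] indep[of 2 1] by (auto simp: T_def)
  ultimately show False
    using cyl_closed_not_meager cyl_closed_Int[OF closed[of 1] closed[of 2]] by blast
qed

theorem theorem1p1:
  shows "\<exists>(X :: (nat \<Rightarrow> nat) topology) (E :: ((nat \<Rightarrow> nat) \<times> (nat \<Rightarrow> nat)) set).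
           polish_topology X \<and> equiv (topspace X) E \<and> borel_graphable X E \<and>
           (\<forall>G. borel_graphing X E G \<longrightarrow> 3 \<le> graph_diameter E G)"
proof (intro exI conjI allI impI)
  show "polish_topology (top_of_set carrier)" by (rule polish_carrier)
  show "equiv (topspace (top_of_set carrier)) connected_points" using equiv_connected_points by simp
  show "borel_graphable (top_of_set carrier) connected_points"
    unfolding borel_graphable_def using borel_graphing_edges by blast
  show "3 \<le> graph_diameter connected_points G" if "borel_graphing (top_of_set carrier) connected_points G" for G
    using that by (rule graphing_diameter_ge_3)
qed

end
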